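(* Let $G$ be an acyclic planar network with sources $s_1,\ldots,s_m$, sinks $t_1,\ldots,t_m$ and complex edge weights, such that no source is a sink. Let $\mathsf{P}_G$ be its $m\times m$ path matrix, and for $n\ge 0$ let $G^n$ be the network obtained by gluing $n$ copies of $G$ together sequentially (all as defined in the context). Suppose that $\det(\mathsf{P}_G)\neq 0$. For $k$-element subsets $I=\{i_1<i_2<\cdots<i_k\}$ and $J=\{j_1<j_2<\cdots<j_k\}$ of $[m]=\{1,\ldots,m\}$ and for $n\ge 0$, define \[ f_G(I,J;n) := \sum_{\Pi} w(\Pi), \] where the sum is over all non-intersecting tuples of paths $\Pi\colon (s_{i_1},\ldots,s_{i_k})\to(t_{j_1},\ldots,t_{j_k})$ in $G^n$. Then, for fixed $I$ and $J$, $f_G(I,J;n)$ satisfies a linear recurrence as a function of $n$. Moreover, suppose that $\det(\mathsf{P}_G)=1$. Then for all $n\ge 1$, \[ f_G(I,J;-n) = (-1)^{\sigma(I)+\sigma(J)}\, f_G(J^c,I^c;n), \] where $\sigma(S):=\sum_{i\in S} i$ and $S^c:=[m]\setminus S$ for $S\subseteq[m]$, and where $f_G(I,J;-n)$ denotes the extension of $f_G(I,J;\cdot)$ to negative integers obtained by running a linear recurrence backwards.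
   Context: **Planar networks.** A planar network $G$ consists of: a finite directed graph $G=(V,E)$ drawn in a disc in a planar manner (edges intersect only at vertices); a choice of $m$ distinguished source vertices $s_1,\ldots,s_m\in V$ of indegree zero and $m$ distinguished sink vertices $t_1,\ldots,t_m\in V$ of outdegree zero, all on the boundary of the disc, occurring in the order $s_1,s_2,\ldots,s_m,t_m,t_{m-1},\ldots,t_1$ as the boundary is traversed clockwise; and an edge weight $w(e)\in\mathbb{C}$ for each $e\in E$. The network is acyclic if it contains no directed cycles. The sources and sinks of $G$ are assumed to be disjoint. **Paths.** A path in $G$ is a sequence $\pi=v_0,e_1,v_1,\ldots,v_{\ell-1},e_\ell,v_\ell$ (with $\ell\ge 0$) of vertices $v_i\in V$ and edges $e_i\in E$ with $e_i=(v_{i-1},v_i)$ for all $i=1,\ldots,\ell$; we write $\pi\colon v_0\to v_\ell$. Its weight is $w(\pi)=\prod_{i=1}^{\ell}w(e_i)$, which is $1$ if $\ell=0$. For a tuple of paths $\Pi=(\pi_1,\ldots,\pi_k)$ the weight is $w(\Pi)=\prod_{i=1}^k w(\pi_i)$, which is $1$ if $k=0$. We write $\Pi\colon(u_1,\ldots,u_k)\to(v_1,\ldots,v_k)$ to mean $\pi_i\colon u_i\to v_i$ for all $i$. The tuple $\Pi$ is non-intersecting if $\pi_i$ and $\pi_j$ have no vertices in common for all $i\ne j$. **Path matrix.** $\mathsf{P}_G$ is the $m\times m$ matrix with entries $(\mathsf{P}_G)_{i,j}=\sum_{\pi\colon s_i\to t_j} w(\pi)$, the sum over all paths from $s_i$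 to $t_j$ in $G$ ($0$ if there are none). **Gluing.** $G^0$ is the degenerate network with $m$ vertices $s_1=t_1,\ldots,s_m=t_m$ and no edges. For $n\ge 1$, $G^n$ is obtained from $G^{n-1}$ by appending a copy of $G$ (with the same edge weights) and identifying the sink $t_i$ of $G^{n-1}$ with the source $s_i$ of the new copy of $G$ for each $i=1,\ldots,m$. The sources of $G^n$ are those of $G^{n-1}$ and the sinks of $G^n$ are the sinks of the new copy; for $n\geq 2$ the identified vertices are internal (neither sources nor sinks). In particular $G^1=G$. Paths, tuples of paths, weights and non-intersection in $G^n$ are defined just as for $G$. **Linear recurrences and negative values.** A function $f\colon\mathbb{N}\to\mathbb{C}$ (where $\mathbb{N}=\{0,1,2,\ldots\}$) satisfies a linear recurrence if there exist $d\ge 0$ and $\alpha_1,\ldots,\alpha_d\in\mathbb{C}$ with $\alpha_d\ne 0$ such that $f(n+d)+\alpha_1 f(n+d-1)+\cdots+\alpha_d f(n)=0$ for all $n\ge 0$. For such $f$, the values at negative integers are defined recursively, for $n\ge 1$, by \[ f(-n):=\frac{-1}{\alpha_d}\bigl(f(-n+d)+\alpha_1 f(-n+d-1)+\cdots+\alpha_{d-1}f(-n+1)\bigr). \] This extension does not depend on which linear recurrence satisfied by $f$ is used. *)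

theory Defs
  imports
    "HOL-Analysis.Analysis"
    "Graph_Theory.Arc_Walk"
    "Jordan_Normal_Form.Determinant"
begin

text \<open>
  Edges are named arcs with a tail and a head, so parallel edges are permitted. The sources are
  \<open>source N i\<close> and the sinks \<open>sink N i\<close> for \<open>i \<in> {1..num N}\<close>; the values of these functions at
  other indices are irrelevant, as are the weights of elements of the arc type that are not arcs
  of the graph.
\<close>

record ('v, 'e) network =
  dgraph :: "('v, 'e) pre_digraph"
  num :: nat
  source :: "nat \<Rightarrow> 'v"
  sink :: "nat \<Rightarrow> 'v"
  weight :: "'e \<Rightarrow> complex"

abbreviation sources :: "('v, 'e) network \<Rightarrow> 'v set" where
  "sources N \<equiv> source N ` {1..num N}"

abbreviation sinks :: "('v, 'e) network \<Rightarrow> 'v set" where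
  "sinks N \<equiv> sink N ` {1..num N}"

text \<open>
  The disc is the closed unit disc of the complex plane: \<open>pos\<close> places the vertices and \<open>crv\<close>
  gives the curve of each edge. Edges are simple curves (closed ones, in the case of loops) that
  pass through no vertices other than their endpoints, and two different edges meet only in
  vertices. Decreasing angles correspond to traversing the boundary circle clockwise; the
  condition \<open>\<theta> j < \<theta> k + 2 * pi\<close> says that the points are met within a single turn. The \<open>2m\<close> angles
  are those of \<open>s_1, ..., s_m, t_m, ..., t_1\<close> in this order.
\<close>

definition disc_drawing ::
    "('v, 'e) network \<Rightarrow> ('v \<Rightarrow> complex) \<Rightarrow> ('e \<Rightarrow> real \<Rightarrow> complex) \<Rightarrow> bool" where
  "disc_drawing N pos crv \<longleftrightarrow>
     (let G = dgraph N; m = num N in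
       inj_on pos (verts G) \<and>
       pos ` verts G \<subseteq> cball 0 1 \<and>
       (\<forall>e \<in> arcs G.
          simple_path (crv e) \<and>
          pathstart (crv e) = pos (tail G e) \<and>
          pathfinish (crv e) = pos (head G e) \<and>
          path_image (crv e) \<subseteq> cball 0 1 \<and>
          path_image (crv e) \<inter> pos ` verts G = {pos (tail G e), pos (head G e)}) \<and>
       (\<forall>e \<in> arcs G. \<forall>e' \<in> arcs G. e \<noteq> e' \<longrightarrow>
          path_image (crv e) \<inter> path_image (crv e') \<subseteq> pos ` verts G) \<and>
       (\<exists>\<theta> :: nat \<Rightarrow> real.
          (\<forall>j k. 1 \<le> j \<and> j < k \<and> k \<le> 2 * m \<longrightarrow> \<theta> k < \<theta> j \<and> \<theta> j < \<theta> k + 2 * pi) \<and>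
          (\<forall>i \<in> {1..m}. pos (source N i) = cis (\<theta> i) \<and>
                       pos (sink N i) = cis (\<theta> (2 * m + 1 - i)))))"

definition planar_network :: "('v, 'e) network \<Rightarrow> bool" where
  "planar_network N \<longleftrightarrow>
     fin_digraph (dgraph N) \<and>
     sources N \<subseteq> verts (dgraph N) \<and>
     sinks N \<subseteq> verts (dgraph N) \<and>
     (\<forall>v \<in> sources N. in_degree (dgraph N) v = 0) \<and>
     (\<forall>v \<in> sinks N. out_degree (dgraph N) v = 0) \<and>
     (\<exists>pos crv. disc_drawing N pos crv)"

definition acyclic_network :: "('v, 'e) network \<Rightarrow> bool" where
  "acyclic_network N \<longleftrightarrow> (\<nexists>p. pre_digraph.cycle (dgraph N) p)"

text \<open>
  A path from \<open>u\<close> to \<open>v\<close> is represented by its list of edges, which together with \<open>u\<close> determines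
  its sequence of vertices \<open>pre_digraph.awalk_verts (dgraph N) u p\<close>.
\<close>

definition paths :: "('v, 'e) network \<Rightarrow> 'v \<Rightarrow> 'v \<Rightarrow> 'e list set" where
  "paths N u v = {p. pre_digraph.awalk (dgraph N) u p v}"

definition path_weight :: "('v, 'e) network \<Rightarrow> 'e list \<Rightarrow> complex" where
  "path_weight N p = (\<Prod>e\<leftarrow>p. weight N e)"

text \<open>Matrix indices start at 0, whereas sources and sinks are numbered from 1.\<close>

definition path_matrix :: "('v, 'e) network \<Rightarrow> complex mat" where
  "path_matrix N =
     mat (num N) (num N)
       (\<lambda>(i, j). \<Sum>p \<in> paths N (source N (Suc i)) (sink N (Suc j)). path_weight N p)"

definition path_tuples :: "('v, 'e) network \<Rightarrow> 'v list \<Rightarrow> 'v list \<Rightarrow> 'e list list set" where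
  "path_tuples N us vs =
     {ps. length ps = length us \<and> length ps = length vs \<and>
         (\<forall>i < length ps. ps ! i \<in> paths N (us ! i) (vs ! i))}"

definition nonintersecting :: "('v, 'e) network \<Rightarrow> 'v list \<Rightarrow> 'e list list \<Rightarrow> bool" where
  "nonintersecting N us ps \<longleftrightarrow>
     (\<forall>i < length ps. \<forall>j < length ps. i \<noteq> j \<longrightarrow>
        set (pre_digraph.awalk_verts (dgraph N) (us ! i) (ps ! i)) \<inter>
        set (pre_digraph.awalk_verts (dgraph N) (us ! j) (ps ! j)) = {})"

definition tuple_weight :: "('v, 'e) network \<Rightarrow> 'e list list \<Rightarrow> complex" where
  "tuple_weight N ps = (\<Prod>p\<leftarrow>ps. path_weight N p)"

text \<open>
  \<open>append_copy N k H\<close> appends to \<open>H\<close> a copy of \<open>N\<close> whose vertices and edges carry the tag \<open>k\<close>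
  (which must be unused in \<open>H\<close>), except that the source \<open>s_i\<close> of the copy is represented by the
  sink \<open>t_i\<close> of \<open>H\<close>.
\<close>

definition copy_vertex ::
    "('v, 'e) network \<Rightarrow> nat \<Rightarrow> (nat \<times> 'v, nat \<times> 'e) network \<Rightarrow> 'v \<Rightarrow> nat \<times> 'v" where
  "copy_vertex N k H v =
     (if v \<in> sources N then sink H (inv_into {1..num N} (source N) v) else (k, v))"

definition append_copy ::
    "('v, 'e) network \<Rightarrow> nat \<Rightarrow> (nat \<times> 'v, nat \<times> 'e) network \<Rightarrow> (nat \<times> 'v, nat \<times> 'e) network"
  where
  "append_copy N k H =
     \<lparr> dgraph =
         \<lparr> verts = verts (dgraph H) \<union> copy_vertex N k H ` verts (dgraph N),
           arcs = arcs (dgraph H) \<union> Pair k ` arcs (dgraph N),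
           tail = (\<lambda>(l, e). if l = k then copy_vertex N k H (tail (dgraph N) e)
                            else tail (dgraph H) (l, e)),
           head = (\<lambda>(l, e). if l = k then copy_vertex N k H (head (dgraph N) e)
                            else head (dgraph H) (l, e)) \<rparr>,
       num = num N,
       source = source H,
       sink = (\<lambda>i. copy_vertex N k H (sink N i)),
       weight = (\<lambda>(l, e). if l = k then weight N e else weight H (l, e)) \<rparr>"

text \<open>
  The copies are tagged \<open>1, ..., n\<close>. The tag 0 is used for the \<open>m\<close> vertices \<open>s_i = t_i\<close> of the
  degenerate network, whose tail, head and weight functions are irrelevant as there are no edges.
\<close>

primrec glue_power :: "('v, 'e) network \<Rightarrow> nat \<Rightarrow> (nat \<times> 'v, nat \<times> 'e) network" where
  "glue_power N 0 =
     \<lparr> dgraph =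
         \<lparr> verts = (\<lambda>i. (0, sink N i)) ` {1..num N},
           arcs = {},
           tail = (\<lambda>(l, e). (l, tail (dgraph N) e)),
           head = (\<lambda>(l, e). (l, head (dgraph N) e)) \<rparr>,
       num = num N,
       source = (\<lambda>i. (0, sink N i)),
       sink = (\<lambda>i. (0, sink N i)),
       weight = (\<lambda>(l, e). weight N e) \<rparr>"
| "glue_power N (Suc n) = append_copy N (Suc n) (glue_power N n)"

definition f_net :: "('v, 'e) network \<Rightarrow> nat set \<Rightarrow> nat set \<Rightarrow> nat \<Rightarrow> complex" where
  "f_net N I J n =
     (let H = glue_power N n;
          us = map (source H) (sorted_list_of_set I);
          vs = map (sink H) (sorted_list_of_set J)
      in \<Sum>ps \<in> {ps \<in> path_tuples H us vs. nonintersecting H us ps}. tuple_weight H ps)"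

text \<open>
  The coefficients are \<open>\<alpha> 1, ..., \<alpha> d\<close>; other values of \<open>\<alpha>\<close> are irrelevant. For \<open>d = 0\<close> there is no
  last coefficient and the recurrence says that \<open>f\<close> is zero.
\<close>

definition recurrence :: "(nat \<Rightarrow> complex) \<Rightarrow> nat \<Rightarrow> (nat \<Rightarrow> complex) \<Rightarrow> bool" where
  "recurrence f d \<alpha> \<longleftrightarrow>
     (d > 0 \<longrightarrow> \<alpha> d \<noteq> 0) \<and>
     (\<forall>n. f (n + d) + (\<Sum>i = 1..d. \<alpha> i * f (n + d - i)) = 0)"

definition satisfies_linear_recurrence :: "(nat \<Rightarrow> complex) \<Rightarrow> bool" where
  "satisfies_linear_recurrence f \<longleftrightarrow> (\<exists>d \<alpha>. recurrence f d \<alpha>)"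

text \<open>
  The extension of \<open>f\<close> to all integers by running the recurrence with coefficients \<open>\<alpha>\<close> backwards.
  For \<open>d = 0\<close> it is zero at negative arguments, which agrees with the extension of the zero
  function by any recurrence with \<open>d > 0\<close>.
\<close>

function extension :: "(nat \<Rightarrow> complex) \<Rightarrow> nat \<Rightarrow> (nat \<Rightarrow> complex) \<Rightarrow> int \<Rightarrow> complex" where
  "extension f d \<alpha> k =
     (if k \<ge> 0 then f (nat k)
      else if d = 0 then 0
      else - 1 / \<alpha> d *
        (extension f d \<alpha> (k + int d) +
         (\<Sum>i = 1..d - 1. \<alpha> i * extension f d \<alpha> (k + int d - int i))))"
  by auto
termination
  by (relation "Wellfounded.measure (\<lambda>(f, d, \<alpha>, k). nat (- k))") auto

declare extension.simps [simp del]

end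

theory Submission
  imports Defs "HOL-Library.Function_Algebras"
begin

text \<open>
  Two disjoint paths of a network drawn in a disc cannot join interlacing pairs of boundary points, so
  non-intersecting paths connect sources and sinks in the same order; this property passes to
  \<open>G^n\<close> by cutting paths at the glued vertices. Hence the Lindstroem-Gessel-Viennot lemma, proved by
  exchanging the tails of two meeting paths, identifies \<open>f_G(I, J; n)\<close> with the minor of
  \<open>P^n\<close> with rows \<open>I\<close> and columns \<open>J\<close>, where \<open>P\<close> is the path matrix. As \<open>P\<close> is invertible, the
  minors of \<open>P^z\<close> are defined for all integers \<open>z\<close>. They are combinations of products of \<open>k\<close>
  entries of \<open>P^z\<close>, and these span a finite-dimensional shift-invariant space of functions on the
  integers. So a linear recurrence with nonzero lowest coefficient holds on all of the integers, and every
  recurrence run backwards yields the minor of \<open>P^(-n)\<close>. By Jacobi's theorem on complementary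
  minors this is, up to the sign, the complementary minor of the transpose of \<open>P^n\<close> divided by
  \<open>det P^n\<close>.
\<close>

text \<open>Topology enters only for \<open>G\<close> itself: no drawing of \<open>G^n\<close> is
  constructed. What is passed on is the combinatorial property \<open>order_preserving\<close>,
  which speaks only of pairs of disjoint paths and can therefore be checked on the two pieces of
  each path. The topological input is a theorem on curves in a rectangle whose ends interlace on one
  side; the transform below straightens the circle to that side.

  For the recurrence, the useful closed family consists of the products of \<open>k\<close> entries
  of \<open>P^z\<close>: by \<open>P^(z+1) = P^z * P\<close> each of them is, one step later, a
  linear combination of products of the same kind.

  Working on all integers from the start matters. A relation valid at every integer can be shifted
  until its lowest coefficient is nonzero, whereas a relation on the naturals alone cannot (a
  function supported at 0 is an example). It is this nonzero coefficient that determines the values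
  to the left uniquely.\<close>

section \<open>Interlacing chords of a disc\<close>

text \<open>
  The Cayley transform, in real coordinates: the closed unit disc without the point 1 is mapped to
  the closed upper half-plane and the unit circle to the real axis, where \<open>cis t\<close> goes to
  \<open>cot (t / 2)\<close>.
\<close>

definition to_halfplane :: "complex \<Rightarrow> real^2" where
  "to_halfplane z = (\<chi> i. if i = 1 then 2 * Im z / ((1 - Re z)\<^sup>2 + (Im z)\<^sup>2)
                        else 2 * (1 - Re z) / ((1 - Re z)\<^sup>2 + (Im z)\<^sup>2) - 1)"

lemma to_halfplane_1: "vec_nth (to_halfplane z) 1 = 2 * Im z / ((1 - Re z)\<^sup>2 + (Im z)\<^sup>2)"
  and to_halfplane_2: "vec_nth (to_halfplane z) 2 = 2 * (1 - Re z) / ((1 - Re z)\<^sup>2 + (Im z)\<^sup>2) - 1"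
  by (simp_all add: to_halfplane_def)

lemma one_minus_Re_Im_pos: "z \<noteq> 1 \<Longrightarrow> (1 - Re z)\<^sup>2 + (Im z)\<^sup>2 > 0"
  by (auto simp: complex_eq_iff sum_power2_gt_zero_iff)

lemma to_halfplane_continuous: "1 \<notin> S \<Longrightarrow> continuous_on S to_halfplane"
  unfolding to_halfplane_def
proof (rule continuous_on_vec_lambda)
  fix i :: 2
  assume "1 \<notin> S"
  then have "\<forall>z\<in>S. (1 - Re z)\<^sup>2 + (Im z)\<^sup>2 \<noteq> 0"
    using one_minus_Re_Im_pos by (metis less_irrefl)
  then show "continuous_on S (\<lambda>z. if i = 1 then 2 * Im z / ((1 - Re z)\<^sup>2 + (Im z)\<^sup>2)
                        else 2 * (1 - Re z) / ((1 - Re z)\<^sup>2 + (Im z)\<^sup>2) - 1)"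
    by (cases "i = 1") (auto intro!: continuous_intros)
qed

text \<open>With \<open>D z\<close> the squared distance from \<open>z\<close> to 1, the squares of
  \<open>Im z / D z\<close> and \<open>(1 - Re z) / D z\<close> add up to \<open>1 / D z\<close>. So
  the image determines \<open>D z\<close>, and with it \<open>z\<close>.\<close>

lemma to_halfplane_inj: "inj_on to_halfplane (- {1})"
proof (rule inj_onI)
  fix z w :: complex
  assume "z \<in> - {1}" "w \<in> - {1}" and eq: "to_halfplane z = to_halfplane w"
  define D where "D = (\<lambda>z. (1 - Re z)\<^sup>2 + (Im z)\<^sup>2)"
  have D: "D z > 0" "D w > 0"
    using one_minus_Re_Im_pos \<open>z \<in> _\<close> \<open>w \<in> _\<close> by (auto simp: D_def)
  have x: "Im z / D z = Im w / D w"
    using arg_cong[OF eq, of "\<lambda>v. vec_nth v 1"] by (simp add: to_halfplane_1 D_def)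
  have "2 * ((1 - Re z) / D z) = 2 * ((1 - Re w) / D w)"
    using arg_cong[OF eq, of "\<lambda>v. vec_nth v 2"] by (simp add: to_halfplane_2 D_def)
  then have y: "(1 - Re z) / D z = (1 - Re w) / D w"
    by (metis mult_cancel_left zero_neq_numeral)
  have *: "(Im z / D z)\<^sup>2 + ((1 - Re z) / D z)\<^sup>2 = 1 / D z" if "D z > 0" for z
  proof -
    have "(Im z / D z)\<^sup>2 + ((1 - Re z) / D z)\<^sup>2 = D z / (D z)\<^sup>2"
      unfolding power_divide add_divide_distrib[symmetric] by (simp add: D_def add.commute)
    then show ?thesis
      using that by (simp add: power2_eq_square)
  qed
  have "1 / D z = 1 / D w"
    using *[OF D(1)] *[OF D(2)] x y by simp
  then have "D z = D w" by simp
  with x y D show "z = w" by (simp add: complex_eq_iff)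
qed

text \<open>The second coordinate equals (1 - |z|^2) / |1 - z|^2.\<close>

lemma to_halfplane_nonneg:
  assumes "cmod z \<le> 1" "z \<noteq> 1"
  shows "vec_nth (to_halfplane z) 2 \<ge> 0"
proof -
  have "(Re z)\<^sup>2 + (Im z)\<^sup>2 \<le> 1"
    using assms by (metis cmod_power2 power_le_one norm_ge_zero)
  then have "(1 - Re z)\<^sup>2 + (Im z)\<^sup>2 \<le> 2 * (1 - Re z)"
    by (simp add: power2_diff)
  then show ?thesis
    using one_minus_Re_Im_pos[OF assms(2)] by (simp add: to_halfplane_2)
qed

lemma to_halfplane_cis:
  assumes "0 < t" "t < 2 * pi"
  shows "cis t \<noteq> 1" "vec_nth (to_halfplane (cis t)) 1 = cot (t / 2)"
    "vec_nth (to_halfplane (cis t)) 2 = 0"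
proof -
  define s where "s = t / 2"
  have t: "t = 2 * s" by (simp add: s_def)
  have s: "sin s > 0"
    using assms by (intro sin_gt_zero) (auto simp: s_def)
  have 1: "1 - cos t = 2 * (sin s)\<^sup>2"
    by (simp add: t cos_double_sin)
  then have "cos t \<noteq> 1" using s by auto
  then show "cis t \<noteq> 1"
    by (auto simp: complex_eq_iff)
  have sq: "(sin t)\<^sup>2 = 1 - (cos t)\<^sup>2"
    by (simp add: sin_squared_eq)
  have D: "(1 - Re (cis t))\<^sup>2 + (Im (cis t))\<^sup>2 = 2 * (1 - cos t)"
    by (simp add: power2_diff sq)
  show "vec_nth (to_halfplane (cis t)) 2 = 0"
    unfolding to_halfplane_2 D using \<open>cos t \<noteq> 1\<close> by simp
  have "vec_nth (to_halfplane (cis t)) 1 = 2 * (2 * sin s * cos s) / (2 * (2 * (sin s)\<^sup>2))"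
    unfolding to_halfplane_1 D 1 by (simp add: t sin_double)
  also have "\<dots> = cot s"
    using s by (simp add: cot_def power2_eq_square)
  finally show "vec_nth (to_halfplane (cis t)) 1 = cot (t / 2)"
    by (simp add: s_def)
qed

lemma cot_strict_antimono:
  fixes s t :: real
  assumes "0 < s" "s < t" "t < pi"
  shows "cot t < cot s"
proof -
  have pos: "sin s > 0" "sin t > 0" "sin (t - s) > 0"
    using assms by (auto intro!: sin_gt_zero)
  then have "cos t * sin s < cos s * sin t"
    by (simp add: sin_diff algebra_simps)
  with pos show ?thesis
    by (simp add: cot_def divide_simps)
qed

text \<open>
  A curve may run through any boundary point of the disc. Scaling it by 1/2 and attaching radial
  segments at its ends keeps it away from all other boundary points, in particular from the pole of
  the transform.
\<close>

lemma shrunk_path: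
  fixes f :: "real \<Rightarrow> complex"
  assumes "path f" "path_image f \<subseteq> cball 0 1" "pathstart f = cis a" "pathfinish f = cis c"
  obtains F where "path F" "pathstart F = cis a" "pathfinish F = cis c"
    "path_image F \<subseteq> cball 0 1" "\<And>z. z \<in> path_image F \<Longrightarrow> cmod z = 1 \<Longrightarrow> z \<in> {cis a, cis c}"
    "\<And>z. z \<in> path_image F \<Longrightarrow> 2 * z \<in> path_image f \<or>
       (\<exists>u p. 1/2 \<le> u \<and> u \<le> 1 \<and> p \<in> {cis a, cis c} \<and> z = complex_of_real u * p)"
proof -
  define h where "h = (\<lambda>t. f t / 2)"
  define F where "F = linepath (cis a) (cis a / 2) +++ (h +++ linepath (cis c / 2) (cis c))"
  have h: "path h" "pathstart h = cis a / 2" "pathfinish h = cis c / 2"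
    using assms by (auto simp: h_def path_def pathstart_def pathfinish_def intro!: continuous_intros)
  have im: "path_image h = (\<lambda>z. z / 2) ` path_image f"
    by (auto simp: h_def path_image_def)
  have seg1: "\<exists>u. 1/2 \<le> u \<and> u \<le> 1 \<and> z = complex_of_real u * cis a"
    if z: "z \<in> closed_segment (cis a) (cis a / 2)" for z
  proof -
    from z obtain v where v: "0 \<le> v" "v \<le> 1" "z = (1 - v) *\<^sub>R cis a + v *\<^sub>R (cis a / 2)"
      by (auto simp: closed_segment_def)
    then show ?thesis
      by (intro exI[of _ "1 - v/2"]) (auto simp: scaleR_conv_of_real algebra_simps)
  qed
  have seg2: "\<exists>u. 1/2 \<le> u \<and> u \<le> 1 \<and> z = complex_of_real u * cis c"
    if z: "z \<in> closed_segment (cis c / 2) (cis c)" for z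
  proof -
    from z obtain v where v: "0 \<le> v" "v \<le> 1" "z = (1 - v) *\<^sub>R (cis c / 2) + v *\<^sub>R (cis c)"
      by (auto simp: closed_segment_def)
    then have "z = complex_of_real (1/2 + v/2) * cis c"
      by (simp add: complex_eq_iff algebra_simps)
    with v(1,2) show ?thesis
      by (intro exI[of _ "1/2 + v/2"]) auto
  qed
  have imF: "path_image F = closed_segment (cis a) (cis a / 2) \<union>
      ((\<lambda>z. z / 2) ` path_image f \<union> closed_segment (cis c / 2) (cis c))"
    using h by (simp add: F_def path_image_join im)
  have key: "2 * z \<in> path_image f \<or>
       (\<exists>u p. 1/2 \<le> u \<and> u \<le> 1 \<and> p \<in> {cis a, cis c} \<and> z = complex_of_real u * p)"
    if z: "z \<in> path_image F" for z
  proof -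
    from z consider "z \<in> closed_segment (cis a) (cis a / 2)" | "2 * z \<in> path_image f"
      | "z \<in> closed_segment (cis c / 2) (cis c)"
      unfolding imF by auto
    then show ?thesis
    proof cases
      case 1
      from seg1[OF this] show ?thesis by blast
    next
      case 3
      from seg2[OF this] show ?thesis by blast
    qed simp
  qed
  show ?thesis
  proof
    show "path F" unfolding F_def using h by simp
    show "pathstart F = cis a" "pathfinish F = cis c" by (simp_all add: F_def)
    show "path_image F \<subseteq> cball 0 1"
    proof
      fix z assume "z \<in> path_image F"
      from key[OF this] show "z \<in> cball 0 1"
      proof (elim disjE exE conjE)
        assume "2 * z \<in> path_image f"
        then have "cmod (2 * z) \<le> 1" using assms(2) by (auto simp: subset_iff)
        then have "2 * cmod z \<le> 1" by (simp add: norm_mult)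
        then show ?thesis by simp
      next
        fix u p assume "1/2 \<le> u" "u \<le> 1" "p \<in> {cis a, cis c}" "z = complex_of_real u * p"
        then show ?thesis by (auto simp: norm_mult)
      qed
    qed
    show "z \<in> {cis a, cis c}" if "z \<in> path_image F" "cmod z = 1" for z
      using key[OF that(1)]
    proof (elim disjE exE conjE)
      assume "2 * z \<in> path_image f"
      then have "cmod (2 * z) \<le> 1" using assms(2) by (auto simp: subset_iff)
      then show ?thesis using that(2) by (simp add: norm_mult)
    next
      fix u p assume "1/2 \<le> u" "p \<in> {cis a, cis c}" "z = complex_of_real u * p"
      then show ?thesis using that(2) by (auto simp: norm_mult)
    qed
  qed (rule key)
qed

text \<open>After a rotation the transform puts the four ends on the real axis in the order of
  \<open>a\<close>, \<open>b\<close>, \<open>c\<close>, \<open>d\<close>, because the angles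
  decrease and so does \<open>cot\<close>. Then \<open>fashoda_interlace\<close> makes the shrunk
  curves meet. It remains to see that the attached radial segments create no meeting that the
  original curves lack.\<close>

lemma interlacing_chords_meet:
  assumes f: "path f" "path_image f \<subseteq> cball 0 1" "pathstart f = cis a" "pathfinish f = cis c"
    and g: "path g" "path_image g \<subseteq> cball 0 1" "pathstart g = cis b" "pathfinish g = cis d"
    and order: "b < a" "c < b" "d < c" "a < d + 2 * pi"
  shows "path_image f \<inter> path_image g \<noteq> {}"
proof -
  \<comment> \<open>\<open>e\<close> is the midpoint of \<open>d\<close> and
    \<open>a - 2 * pi\<close>, so \<open>cis e\<close> lies on the open arc between
    \<open>cis d\<close> and \<open>cis a\<close> that contains no end of a curve. Rotating it to
    the pole 1 brings all four angles strictly between 0 and \<open>2 * pi\<close>.\<close>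
  define e where "e = (a + d) / 2 - pi"
  have e1: "e < d" using order unfolding e_def by argo
  have e2: "a < e + 2 * pi" using order unfolding e_def by argo
  note e = e1 e2
  have rot: "cis x * cis (- e) = cis (x - e)" for x
    by (simp add: cis_mult)
  have angle: "cis x \<noteq> cis e" if "x \<in> {a, b, c, d}" for x
  proof
    assume "cis x = cis e"
    then have "cis (x - e) = 1" using rot[of x] rot[of e] by (metis cis_zero diff_self)
    moreover have "cis (x - e) \<noteq> 1"
      using that order e by (intro to_halfplane_cis) auto
    ultimately show False by simp
  qed
  have ne: "p \<noteq> q" if pq: "p \<in> {cis a, cis c}" "q \<in> {cis b, cis d}" for p q
  proof -
    have inj: "cis x \<noteq> cis y" if "x < y" "y < x + 2 * pi" for x y
    proof
      assume "cis x = cis y"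
      then have "cis (y - x) = 1"
        by (metis cis_divide cis_neq_zero divide_self_if)
      then show False
        using to_halfplane_cis(1)[of "y - x"] that by simp
    qed
    show ?thesis
      using pq order inj[of b a] inj[of d a] inj[of c b] inj[of d c] by (auto simp: eq_commute)
  qed
  obtain F where F: "path F" "pathstart F = cis a" "pathfinish F = cis c"
    "path_image F \<subseteq> cball 0 1" "\<And>z. z \<in> path_image F \<Longrightarrow> cmod z = 1 \<Longrightarrow> z \<in> {cis a, cis c}"
    "\<And>z. z \<in> path_image F \<Longrightarrow> 2 * z \<in> path_image f \<or>
       (\<exists>u p. 1/2 \<le> u \<and> u \<le> 1 \<and> p \<in> {cis a, cis c} \<and> z = complex_of_real u * p)"
    using shrunk_path[OF f] by blast
  obtain H where H: "path H" "pathstart H = cis b" "pathfinish H = cis d"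
    "path_image H \<subseteq> cball 0 1" "\<And>z. z \<in> path_image H \<Longrightarrow> cmod z = 1 \<Longrightarrow> z \<in> {cis b, cis d}"
    "\<And>z. z \<in> path_image H \<Longrightarrow> 2 * z \<in> path_image g \<or>
       (\<exists>u p. 1/2 \<le> u \<and> u \<le> 1 \<and> p \<in> {cis b, cis d} \<and> z = complex_of_real u * p)"
    using shrunk_path[OF g] by blast
  define T where "T = (\<lambda>z. to_halfplane (z * cis (- e)))"
  define S where "S = path_image F \<union> path_image H"
  have "cis e \<notin> S"
    using F(5)[of "cis e"] H(5)[of "cis e"] angle[of a] angle[of b] angle[of c] angle[of d]
    by (auto simp: S_def)
  have one: "z * cis (- e) \<noteq> 1" if "z \<in> S" for z
  proof
    assume "z * cis (- e) = 1"
    have "z = z * (cis (- e) * cis e)" by (simp add: cis_mult)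
    also have "\<dots> = cis e"
      unfolding mult.assoc[symmetric] \<open>z * cis (- e) = 1\<close> by simp
    finally show False
      using that \<open>cis e \<notin> S\<close> by simp
  qed
  have contT: "continuous_on S T"
  proof -
    have "1 \<notin> (\<lambda>z. z * cis (- e)) ` S" using one by (metis imageE)
    then show ?thesis
      unfolding T_def
      by (rule continuous_on_compose2[OF to_halfplane_continuous])
        (auto intro!: continuous_intros)
  qed
  have "compact (T ` S)"
    using F(1) H(1) by (intro compact_continuous_image contT) (auto simp: S_def compact_path_image)
  then obtain M where M: "\<And>v. v \<in> T ` S \<Longrightarrow> norm v \<le> M"
    using compact_imp_bounded bounded_iff by metis
  \<comment> \<open>The box is [-M, M] x [0, M]: its lower side lies on the real axis, where the
    transformed ends are.\<close>
  define lo hi :: "real^2" where "lo = (\<chi> i. if i = 1 then - M else 0)" and "hi = (\<chi> i. M)"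
  have nonneg: "vec_nth (T z) 2 \<ge> 0" if "z \<in> S" for z
    unfolding T_def using F(4) H(4) that one[OF that]
    by (intro to_halfplane_nonneg) (auto simp: S_def norm_mult subset_iff)
  have box: "T ` S \<subseteq> cbox lo hi"
  proof
    fix v assume v: "v \<in> T ` S"
    have "\<bar>vec_nth v i\<bar> \<le> M" for i
      using M[OF v] component_le_norm_cart[of v i] by linarith
    then have "- M \<le> vec_nth v 1" "vec_nth v 1 \<le> M" "vec_nth v 2 \<le> M"
      by (metis abs_le_iff minus_le_iff)+
    moreover have "vec_nth v 2 \<ge> 0"
      using v nonneg by blast
    ultimately show "v \<in> cbox lo hi"
      by (simp add: mem_box_cart lo_def hi_def forall_2)
  qed
  have end1: "vec_nth (T (cis x)) 1 = cot ((x - e) / 2)"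
    and end2: "vec_nth (T (cis x)) 2 = 0" if "x \<in> {a, b, c, d}" for x
    using to_halfplane_cis[of "x - e"] that order e by (auto simp: T_def rot)
  have mono: "cot ((x - e) / 2) < cot ((y - e) / 2)" if "y < x" "e < y" "x < e + 2 * pi" for x y
    using that by (intro cot_strict_antimono) auto
  have lo2: "vec_nth lo 2 = 0" by (simp add: lo_def)
  obtain z where z: "z \<in> path_image (T \<circ> F)" "z \<in> path_image (T \<circ> H)"
  proof (rule fashoda_interlace[of "T \<circ> F" "T \<circ> H" lo hi])
    show "path (T \<circ> F)" "path (T \<circ> H)"
      using F(1) H(1) contT
      by (auto intro!: path_continuous_image continuous_on_subset[OF contT] simp: S_def)
    show "path_image (T \<circ> F) \<subseteq> cbox lo hi" "path_image (T \<circ> H) \<subseteq> cbox lo hi"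
      using box by (auto simp: path_image_compose S_def)
  qed (use mono order e in \<open>auto simp: pathstart_compose pathfinish_compose F(2,3) H(2,3) end1 end2 lo2\<close>)
  then obtain x y where xy: "x \<in> path_image F" "y \<in> path_image H" "T x = T y"
    by (auto simp: path_image_compose)
  then have "x * cis (- e) = y * cis (- e)"
    using one[of x] one[of y] by (intro inj_onD[OF to_halfplane_inj]) (auto simp: T_def S_def)
  then have "x = y" by simp
  \<comment> \<open>The double of a point \<open>u * p\<close> on a radial segment has modulus
    \<open>2 * u\<close>, which is at least 1; if it lies in the disc, then
    \<open>u = 1/2\<close>.\<close>
  have small: "2 * (complex_of_real u * p) = p"
    if "1/2 \<le> u" "cmod p = 1" "cmod (2 * (complex_of_real u * p)) \<le> 1" for u p
  proof -
    have "2 * u = 1" using that by (simp add: norm_mult)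
    then have "complex_of_real (2 * u) * p = p" by simp
    then show ?thesis by simp
  qed
  have ends: "cis a \<in> path_image f" "cis c \<in> path_image f" "cis b \<in> path_image g" "cis d \<in> path_image g"
    using f g pathstart_in_path_image pathfinish_in_path_image by metis+
  \<comment> \<open>A radial segment can touch the half-size copy of the other curve only at its
    inner end \<open>p / 2\<close>, and then the original curves share \<open>p\<close>. Radial
    segments to distinct points of the circle are disjoint.\<close>
  consider "2 * x \<in> path_image f" "2 * x \<in> path_image g"
    | u p where "2 * x \<in> path_image f" "1/2 \<le> u" "u \<le> 1" "p \<in> {cis b, cis d}" "x = complex_of_real u * p"
    | u p where "2 * x \<in> path_image g" "1/2 \<le> u" "u \<le> 1" "p \<in> {cis a, cis c}" "x = complex_of_real u * p"
    | u p v q where "1/2 \<le> u" "u \<le> 1" "p \<in> {cis a, cis c}" "x = complex_of_real u * p"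
       "1/2 \<le> v" "v \<le> 1" "q \<in> {cis b, cis d}" "x = complex_of_real v * q"
    using F(6)[OF xy(1)] H(6)[OF xy(2)] unfolding \<open>x = y\<close> by metis
  then show ?thesis
  proof cases
    case 1 then show ?thesis by auto
  next
    case 2
    then have "cmod (2 * x) \<le> 1" using f(2) by (auto simp: subset_iff)
    then have "2 * x = p" using small[of u p] 2 by auto
    then have "p \<in> path_image f" using 2(1) by metis
    moreover have "p \<in> path_image g" using 2(4) ends by auto
    ultimately show ?thesis by blast
  next
    case 3
    then have "cmod (2 * x) \<le> 1" using g(2) by (auto simp: subset_iff)
    then have "2 * x = p" using small[of u p] 3 by auto
    then have "p \<in> path_image g" using 3(1) by metis
    moreover have "p \<in> path_image f" using 3(4) ends by auto
    ultimately show ?thesis by blast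
  next
    case 4
    then have "cmod (complex_of_real u * p) = cmod (complex_of_real v * q)" by simp
    moreover have "cmod p = 1" "cmod q = 1" using 4 by auto
    ultimately have "u = v" using 4 by (simp add: norm_mult)
    then have "p = q" using 4 by auto
    then show ?thesis using ne 4 by blast
  qed
qed

section \<open>Walks of a drawn network as curves in the disc\<close>

lemma disc_drawingD:
  assumes "disc_drawing N pos crv"
  shows "inj_on pos (verts (dgraph N))"
    and "pos ` verts (dgraph N) \<subseteq> cball 0 1"
    and "\<forall>e \<in> arcs (dgraph N).
          simple_path (crv e) \<and>
          pathstart (crv e) = pos (tail (dgraph N) e) \<and>
          pathfinish (crv e) = pos (head (dgraph N) e) \<and>
          path_image (crv e) \<subseteq> cball 0 1 \<and>
          path_image (crv e) \<inter> pos ` verts (dgraph N) = {pos (tail (dgraph N) e), pos (head (dgraph N) e)}"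
    and "\<forall>e \<in> arcs (dgraph N). \<forall>e' \<in> arcs (dgraph N). e \<noteq> e' \<longrightarrow>
          path_image (crv e) \<inter> path_image (crv e') \<subseteq> pos ` verts (dgraph N)"
    and "\<exists>\<theta> :: nat \<Rightarrow> real.
          (\<forall>j k. 1 \<le> j \<and> j < k \<and> k \<le> 2 * num N \<longrightarrow> \<theta> k < \<theta> j \<and> \<theta> j < \<theta> k + 2 * pi) \<and>
          (\<forall>i \<in> {1..num N}. pos (source N i) = cis (\<theta> i) \<and>
                       pos (sink N i) = cis (\<theta> (2 * num N + 1 - i)))"
  using assms unfolding disc_drawing_def Let_def by - (elim conjE, assumption)+

lemma disc_drawing_edge:
  assumes "disc_drawing N pos crv" "e \<in> arcs (dgraph N)"
  shows "path (crv e)" "pathstart (crv e) = pos (tail (dgraph N) e)"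
    "pathfinish (crv e) = pos (head (dgraph N) e)" "path_image (crv e) \<subseteq> cball 0 1"
    "path_image (crv e) \<inter> pos ` verts (dgraph N) = {pos (tail (dgraph N) e), pos (head (dgraph N) e)}"
  using bspec[OF disc_drawingD(3)[OF assms(1)] assms(2)] by (simp_all add: simple_path_imp_path)

lemma planar_networkD:
  assumes "planar_network N"
  shows "fin_digraph (dgraph N)" "sources N \<subseteq> verts (dgraph N)" "sinks N \<subseteq> verts (dgraph N)"
    "\<And>v. v \<in> sources N \<Longrightarrow> in_degree (dgraph N) v = 0"
    "\<And>v. v \<in> sinks N \<Longrightarrow> out_degree (dgraph N) v = 0"
    "\<exists>pos crv. disc_drawing N pos crv"
  using assms by (auto simp: planar_network_def)

text \<open>Joining the edge curves gives a curve, with a constant one for the empty walk. Its image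
  is bounded by vertex positions and edge curves because this is the set that can be compared for
  two walks.\<close>

lemma walk_curve:
  assumes "wf_digraph (dgraph N)" "disc_drawing N pos crv"
    and "pre_digraph.awalk (dgraph N) u p v"
  obtains \<gamma> where "path \<gamma>" "pathstart \<gamma> = pos u" "pathfinish \<gamma> = pos v" "path_image \<gamma> \<subseteq> cball 0 1"
    "path_image \<gamma> \<subseteq> pos ` set (pre_digraph.awalk_verts (dgraph N) u p) \<union> (\<Union>e\<in>set p. path_image (crv e))"
proof -
  interpret wf_digraph "dgraph N" by fact
  note draw = disc_drawing_edge[OF assms(2)] disc_drawingD(1,2)[OF assms(2)]
  have "\<exists>\<gamma>. path \<gamma> \<and> pathstart \<gamma> = pos u \<and> pathfinish \<gamma> = pos v \<and> path_image \<gamma> \<subseteq> cball 0 1 \<and>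
    path_image \<gamma> \<subseteq> pos ` set (awalk_verts u p) \<union> (\<Union>e\<in>set p. path_image (crv e))"
    using assms(3)
  proof (induction p arbitrary: u)
    case Nil
    then have "u = v" "u \<in> verts (dgraph N)" by (auto simp: awalk_Nil_iff)
    then have "pos u \<in> cball 0 1" using draw by blast
    then show ?case
      using \<open>u = v\<close>
      by (intro exI[of _ "linepath (pos u) (pos v)"] conjI path_linepath pathstart_linepath pathfinish_linepath)
        auto
  next
    case (Cons e p)
    then have e: "e \<in> arcs (dgraph N)" "u = tail (dgraph N) e" "awalk (head (dgraph N) e) p v"
      by (auto simp: awalk_Cons_iff)
    obtain \<gamma> where \<gamma>: "path \<gamma>" "pathstart \<gamma> = pos (head (dgraph N) e)" "pathfinish \<gamma> = pos v"
      "path_image \<gamma> \<subseteq> cball 0 1"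
      "path_image \<gamma> \<subseteq> pos ` set (awalk_verts (head (dgraph N) e) p) \<union> (\<Union>e\<in>set p. path_image (crv e))"
      using Cons.IH[OF e(3)] by blast
    have "path_image (crv e +++ \<gamma>) = path_image (crv e) \<union> path_image \<gamma>"
      using \<gamma> draw(3)[OF e(1)] by (simp add: path_image_join)
    moreover have "path_image (crv e) \<subseteq>
        pos ` set (awalk_verts u (e # p)) \<union> (\<Union>e\<in>set (e # p). path_image (crv e))" by auto
    moreover have "path_image \<gamma> \<subseteq>
        pos ` set (awalk_verts u (e # p)) \<union> (\<Union>e\<in>set (e # p). path_image (crv e))"
      by (rule subset_trans[OF \<gamma>(5)]) auto
    ultimately have "path_image (crv e +++ \<gamma>) \<subseteq>
        pos ` set (awalk_verts u (e # p)) \<union> (\<Union>e\<in>set (e # p). path_image (crv e))"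
      "path_image (crv e +++ \<gamma>) \<subseteq> cball 0 1"
      using \<gamma>(4) draw(4)[OF e(1)] by (simp_all only: Un_least)
    moreover have "path (crv e +++ \<gamma>)"
      using \<gamma>(1,2) draw(1,3)[OF e(1)] by simp
    ultimately show ?case
      using \<gamma>(3) draw(2)[OF e(1)] e(2)
      by (metis pathstart_join pathfinish_join)
  qed
  then show ?thesis using that by blast
qed

text \<open>A common point that is not a vertex would lie on two different edges, as a shared edge
  would mean shared ends; but different edges meet only in vertices. A common point that is a vertex
  lies on both walks, since an edge passes through no vertices except its ends.\<close>

lemma disjoint_walks_disjoint_curves:
  assumes "wf_digraph (dgraph N)" "disc_drawing N pos crv"
    and p: "pre_digraph.awalk (dgraph N) u p v" and q: "pre_digraph.awalk (dgraph N) u' q v'"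
    and disj: "set (pre_digraph.awalk_verts (dgraph N) u p) \<inter> set (pre_digraph.awalk_verts (dgraph N) u' q) = {}"
  shows "(pos ` set (pre_digraph.awalk_verts (dgraph N) u p) \<union> (\<Union>e\<in>set p. path_image (crv e))) \<inter>
    (pos ` set (pre_digraph.awalk_verts (dgraph N) u' q) \<union> (\<Union>e\<in>set q. path_image (crv e))) = {}"
proof -
  interpret wf_digraph "dgraph N" by fact
  note draw = disc_drawing_edge[OF assms(2)] disc_drawingD(1,2)[OF assms(2)]
  have verts: "set (awalk_verts u p) \<subseteq> verts (dgraph N)" "set p \<subseteq> arcs (dgraph N)"
    if "awalk u p v" for u p v
    using that by auto
  have ends: "tail (dgraph N) e \<in> set (awalk_verts u p)" "head (dgraph N) e \<in> set (awalk_verts u p)"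
    if "awalk u p v" "e \<in> set p" for u p v e
    using that by (auto simp: set_awalk_verts)
  have at_vertex: "x \<in> set (awalk_verts u p)"
    if "awalk u p v" "x \<in> verts (dgraph N)"
      "pos x \<in> pos ` set (awalk_verts u p) \<union> (\<Union>e\<in>set p. path_image (crv e))" for u p v x
    using that(3)
  proof
    assume "pos x \<in> pos ` set (awalk_verts u p)"
    then show ?thesis
      using that(2) verts(1)[OF that(1)] inj_onD[OF draw(6)] by blast
  next
    assume "pos x \<in> (\<Union>e\<in>set p. path_image (crv e))"
    then obtain e where e: "e \<in> set p" "pos x \<in> path_image (crv e)" by blast
    then have arc: "e \<in> arcs (dgraph N)" using verts(2)[OF that(1)] by blast
    have "pos x \<in> {pos (tail (dgraph N) e), pos (head (dgraph N) e)}"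
      using draw(5)[OF arc] e(2) that(2) by blast
    then have "x = tail (dgraph N) e \<or> x = head (dgraph N) e"
      using inj_onD[OF draw(6)] that(2) tail_in_verts[OF arc] head_in_verts[OF arc] by blast
    then show ?thesis using ends[OF that(1) e(1)] by blast
  qed
  have no_vertex: False if "x \<in> verts (dgraph N)"
      "pos x \<in> pos ` set (awalk_verts u p) \<union> (\<Union>e\<in>set p. path_image (crv e))"
      "pos x \<in> pos ` set (awalk_verts u' q) \<union> (\<Union>e\<in>set q. path_image (crv e))" for x
    using at_vertex[OF p that(1,2)] at_vertex[OF q that(1,3)] disj by blast
  show ?thesis
  proof (rule ccontr)
    assume "\<not> ?thesis"
    then obtain z where z: "z \<in> pos ` set (awalk_verts u p) \<union> (\<Union>e\<in>set p. path_image (crv e))"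
      "z \<in> pos ` set (awalk_verts u' q) \<union> (\<Union>e\<in>set q. path_image (crv e))" by blast
    have "z \<in> pos ` verts (dgraph N)"
    proof (rule ccontr)
      assume "z \<notin> pos ` verts (dgraph N)"
      then obtain e e' where e: "e \<in> set p" "e' \<in> set q" "z \<in> path_image (crv e)" "z \<in> path_image (crv e')"
        using z verts(1)[OF p] verts(1)[OF q] by blast
      have "e \<noteq> e'" using ends[OF p e(1)] ends[OF q e(2)] disj by blast
      then show False
        using disc_drawingD(4)[OF assms(2)] e verts(2)[OF p] verts(2)[OF q]
          \<open>z \<notin> _\<close> by blast
    qed
    then show False using no_vertex z by blast
  qed
qed

definition order_preserving :: "('v, 'e) network \<Rightarrow> bool" where
  "order_preserving N \<longleftrightarrow> (\<forall>i j a b p q. 1 \<le> i \<longrightarrow> i < j \<longrightarrow> j \<le> num N \<longrightarrow> a \<in> {1..num N} \<longrightarrow> b \<in> {1..num N} \<longrightarrow>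
     p \<in> paths N (source N i) (sink N a) \<longrightarrow> q \<in> paths N (source N j) (sink N b) \<longrightarrow>
     set (pre_digraph.awalk_verts (dgraph N) (source N i) p) \<inter>
     set (pre_digraph.awalk_verts (dgraph N) (source N j) q) = {} \<longrightarrow> a < b)"

text \<open>Disjoint paths have different last vertices, so the alternative to \<open>a < b\<close>
  is \<open>b < a\<close>. The boundary order runs through the sinks backwards; hence
  \<open>s_i\<close>, \<open>s_j\<close>, \<open>t_a\<close>, \<open>t_b\<close> would be met in
  this order, and the two paths would join interlacing pairs.\<close>

lemma planar_network_order_preserving:
  assumes "planar_network N"
  shows "order_preserving N"
  unfolding order_preserving_def paths_def mem_Collect_eq
proof (intro allI impI)
  fix i j a b p q
  assume ij: "1 \<le> i" "i < j" "j \<le> num N" and ab: "a \<in> {1..num N}" "b \<in> {1..num N}"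
    and p: "pre_digraph.awalk (dgraph N) (source N i) p (sink N a)"
    and q: "pre_digraph.awalk (dgraph N) (source N j) q (sink N b)"
    and disj: "set (pre_digraph.awalk_verts (dgraph N) (source N i) p) \<inter>
     set (pre_digraph.awalk_verts (dgraph N) (source N j) q) = {}"
  obtain pos crv where draw: "disc_drawing N pos crv"
    using planar_networkD(6)[OF assms] by blast
  interpret fin_digraph "dgraph N" by (rule planar_networkD(1)[OF assms])
  obtain \<theta> :: "nat \<Rightarrow> real" where
    angles: "\<forall>j k. 1 \<le> j \<and> j < k \<and> k \<le> 2 * num N \<longrightarrow> \<theta> k < \<theta> j \<and> \<theta> j < \<theta> k + 2 * pi"
      "\<forall>i \<in> {1..num N}. pos (source N i) = cis (\<theta> i) \<and> pos (sink N i) = cis (\<theta> (2 * num N + 1 - i))"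
    using disc_drawingD(5)[OF draw] by (elim exE conjE)
  have \<theta>: "\<theta> k < \<theta> j \<and> \<theta> j < \<theta> k + 2 * pi" if "1 \<le> j" "j < k" "k \<le> 2 * num N" for j k
    using angles(1) that by blast
  have pos: "pos (source N i) = cis (\<theta> i)" "pos (sink N i) = cis (\<theta> (2 * num N + 1 - i))"
    if "i \<in> {1..num N}" for i
    using angles(2) that by blast+
  show "a < b"
  proof (rule ccontr)
    assume "\<not> a < b"
    moreover have "a \<noteq> b"
    proof
      assume "a = b"
      have "v \<in> set (awalk_verts u r)" if "awalk u r v" for u r v
        using that by (elim awalkE') (metis awalk_verts_non_Nil last_in_set)
      from this[OF p] this[OF q]
      have "sink N a \<in> set (awalk_verts (source N i) p)" "sink N b \<in> set (awalk_verts (source N j) q)" .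
      with disj \<open>a = b\<close> show False by blast
    qed
    ultimately have "b < a" by simp
    obtain \<gamma> where \<gamma>: "path \<gamma>" "pathstart \<gamma> = pos (source N i)" "pathfinish \<gamma> = pos (sink N a)"
      "path_image \<gamma> \<subseteq> cball 0 1"
      "path_image \<gamma> \<subseteq> pos ` set (awalk_verts (source N i) p) \<union> (\<Union>e\<in>set p. path_image (crv e))"
      using walk_curve[OF wf_digraph_axioms draw p] by blast
    obtain \<delta> where \<delta>: "path \<delta>" "pathstart \<delta> = pos (source N j)" "pathfinish \<delta> = pos (sink N b)"
      "path_image \<delta> \<subseteq> cball 0 1"
      "path_image \<delta> \<subseteq> pos ` set (awalk_verts (source N j) q) \<union> (\<Union>e\<in>set q. path_image (crv e))"
      using walk_curve[OF wf_digraph_axioms draw q] by blast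
    define i' j' where "i' = 2 * num N + 1 - a" and "j' = 2 * num N + 1 - b"
    have ord: "1 \<le> i" "i < j" "j < i'" "i' < j'" "j' \<le> 2 * num N"
      using ij ab \<open>b < a\<close> by (auto simp: i'_def j'_def)
    have "path_image \<gamma> \<inter> path_image \<delta> \<noteq> {}"
    proof (rule interlacing_chords_meet)
      show "pathstart \<gamma> = cis (\<theta> i)" "pathfinish \<gamma> = cis (\<theta> i')"
        "pathstart \<delta> = cis (\<theta> j)" "pathfinish \<delta> = cis (\<theta> j')"
        using \<gamma> \<delta> pos ij ab by (auto simp: i'_def j'_def)
      show "\<theta> j < \<theta> i" "\<theta> i' < \<theta> j" "\<theta> j' < \<theta> i'" "\<theta> i < \<theta> j' + 2 * pi"
        using \<theta>[of i j] \<theta>[of j i'] \<theta>[of i' j'] \<theta>[of i j'] ord by linarith+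
    qed (use \<gamma> \<delta> in auto)
    moreover have "path_image \<gamma> \<inter> path_image \<delta> \<subseteq> {}"
      using Int_mono[OF \<gamma>(5) \<delta>(5)]
      unfolding disjoint_walks_disjoint_curves[OF wf_digraph_axioms draw p q disj] .
    ultimately show False by simp
  qed
qed

text \<open>Injectivity is read off the drawing: angles that differ by less than a full turn give
  different points.\<close>

lemma planar_network_inj:
  assumes "planar_network N"
  shows "inj_on (source N) {1..num N}" "inj_on (sink N) {1..num N}"
proof -
  obtain pos crv where draw: "disc_drawing N pos crv"
    using planar_networkD(6)[OF assms] by blast
  obtain \<theta> :: "nat \<Rightarrow> real" where
    angles: "\<forall>j k. 1 \<le> j \<and> j < k \<and> k \<le> 2 * num N \<longrightarrow> \<theta> k < \<theta> j \<and> \<theta> j < \<theta> k + 2 * pi"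
      "\<forall>i \<in> {1..num N}. pos (source N i) = cis (\<theta> i) \<and> pos (sink N i) = cis (\<theta> (2 * num N + 1 - i))"
    using disc_drawingD(5)[OF draw] by (elim exE conjE)
  have \<theta>: "\<theta> k < \<theta> j \<and> \<theta> j < \<theta> k + 2 * pi" if "1 \<le> j" "j < k" "k \<le> 2 * num N" for j k
    using angles(1) that by blast
  have pos: "pos (source N i) = cis (\<theta> i)" "pos (sink N i) = cis (\<theta> (2 * num N + 1 - i))"
    if "i \<in> {1..num N}" for i
    using angles(2) that by blast+
  have cis: "cis (\<theta> j) \<noteq> cis (\<theta> k)" if "1 \<le> j" "j < k" "k \<le> 2 * num N" for j k
  proof
    assume "cis (\<theta> j) = cis (\<theta> k)"
    then have "cis (\<theta> j - \<theta> k) = 1"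
      by (metis cis_divide cis_neq_zero divide_self_if)
    then show False
      using to_halfplane_cis(1)[of "\<theta> j - \<theta> k"] \<theta>[OF that] by simp
  qed
  show "inj_on (source N) {1..num N}"
  proof (rule linorder_inj_onI)
    fix i j assume "i < j" "i \<in> {1..num N}" "j \<in> {1..num N}"
    then show "source N i \<noteq> source N j"
      using pos(1)[of i] pos(1)[of j] cis[of i j] by auto
  qed auto
  show "inj_on (sink N) {1..num N}"
  proof (rule linorder_inj_onI)
    fix i j assume ij: "i < j" "i \<in> {1..num N}" "j \<in> {1..num N}"
    then have "cis (\<theta> (2 * num N + 1 - j)) \<noteq> cis (\<theta> (2 * num N + 1 - i))"
      by (intro cis) auto
    then show "sink N i \<noteq> sink N j"
      using pos(2)[of i] pos(2)[of j] ij by auto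
  qed auto
qed

section \<open>The Lindstroem-Gessel-Viennot lemma\<close>

locale acyclic_digraph = fin_digraph +
  assumes no_closed_walk: "awalk u p u \<Longrightarrow> p = []"
begin

lemma awalk_verts_distinct: "awalk u p v \<Longrightarrow> distinct (awalk_verts u p)"
  using awalk_not_distinct_decomp[of u p v] no_closed_walk by blast

lemma finite_awalks: "finite {p. awalk u p v}"
proof -
  have "{p. awalk u p v} \<subseteq> {p. apath u p v}"
    using awalk_verts_distinct by (auto simp: apath_def)
  then show ?thesis
    using apaths_finite finite_subset by blast
qed

text \<open>One of the two prefixes extends the other, and the surplus is a closed walk at
  \<open>x\<close>, hence empty.\<close>

lemma awalk_split_unique:
  assumes "awalk u q x" "awalk u q' x" "q @ r = q' @ r'"
  shows "q = q'"
proof -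
  have *: "q = q'" if "awalk u q x" "awalk u q' x" "q' = q @ c" for q q' c
  proof -
    have "awlast u q = x" using that(1) by auto
    then have "awalk x c x" using that(2,3) by auto
    then show ?thesis using no_closed_walk that(3) by simp
  qed
  obtain c where "q = q' @ c \<or> q' = q @ c"
    using assms(3) by (auto simp: append_eq_append_conv2)
  then show ?thesis using * assms by blast
qed

text \<open>Going on from \<open>y\<close> to \<open>x\<close> by the first walk and back to
  \<open>y\<close> by the second closes a walk, which must be empty.\<close>

lemma walks_through_meet_once:
  assumes "awalk u q x" "awalk x r v" "y \<in> set (awalk_verts u q)" "y \<in> set (awalk_verts x r)"
  shows "y = x"
proof -
  obtain q2 where "awalk y q2 x" using awalk_decomp[OF assms(1,3)] by blast
  moreover obtain r1 where "awalk x r1 y" using awalk_decomp[OF assms(2,4)] by blast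
  ultimately have "awalk y (q2 @ r1) y" "awalk x r1 y" by auto
  then have "r1 = []" using no_closed_walk by blast
  then show ?thesis using \<open>awalk x r1 y\<close> by auto
qed

text \<open>For \<open>x\<close> on the walk the choice is forced, by
  \<open>awalk_split_unique\<close>; for other \<open>x\<close> the value is arbitrary.\<close>

definition walk_to :: "'a \<Rightarrow> 'b list \<Rightarrow> 'a \<Rightarrow> 'b list" where
  "walk_to u q x = (SOME q1. \<exists>q2. q = q1 @ q2 \<and> awalk u q1 x)"

definition walk_from :: "'a \<Rightarrow> 'b list \<Rightarrow> 'a \<Rightarrow> 'b list" where
  "walk_from u q x = drop (length (walk_to u q x)) q"

lemma walk_to_append: "awalk u q x \<Longrightarrow> walk_to u (q @ r) x = q"
  unfolding walk_to_def by (rule some_equality) (auto dest: awalk_split_unique)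

lemma walk_from_append: "awalk u q x \<Longrightarrow> walk_from u (q @ r) x = r"
  by (simp add: walk_from_def walk_to_append)

definition swap_tails :: "(nat \<Rightarrow> 'a) \<Rightarrow> 'a \<Rightarrow> nat \<Rightarrow> nat \<Rightarrow> (nat \<Rightarrow> 'b list) \<Rightarrow> nat \<Rightarrow> 'b list" where
  "swap_tails s x i j P =
     P(i := walk_to (s i) (P i) x @ walk_from (s j) (P j) x,
       j := walk_to (s j) (P j) x @ walk_from (s i) (P i) x)"

definition meeting_walks :: "nat \<Rightarrow> (nat \<Rightarrow> 'a) \<Rightarrow> (nat \<Rightarrow> 'b list) \<Rightarrow> 'a \<Rightarrow> nat set" where
  "meeting_walks k s P x = {i \<in> {0..<k}. x \<in> set (awalk_verts (s i) (P i))}"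

definition common_vertices :: "nat \<Rightarrow> (nat \<Rightarrow> 'a) \<Rightarrow> (nat \<Rightarrow> 'b list) \<Rightarrow> 'a set" where
  "common_vertices k s P = {x. \<exists>i<k. \<exists>j<k. i \<noteq> j \<and>
     x \<in> set (awalk_verts (s i) (P i)) \<and> x \<in> set (awalk_verts (s j) (P j))}"

text \<open>\<open>PiE\<close> fixes the values outside \<open>{0..<k}\<close>, so that every tuple
  is counted once and a product of sums expands over this set.\<close>

definition walk_tuples :: "nat \<Rightarrow> (nat \<Rightarrow> 'a) \<Rightarrow> (nat \<Rightarrow> 'a) \<Rightarrow> (nat \<Rightarrow> 'b list) set" where
  "walk_tuples k s t = PiE {0..<k} (\<lambda>i. {q. awalk (s i) q (t i)})"

lemma finite_walk_tuples: "finite (walk_tuples k s t)"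
  unfolding walk_tuples_def by (intro finite_PiE finite_awalks) auto

text \<open>By acyclicity an initial part and a final part have only \<open>x\<close> in common,
  whichever of the two walks each comes from. So any other vertex lies on initial parts only, and
  keeps its walks, or on final parts only, and has \<open>i\<close> and \<open>j\<close> exchanged.
  Either way the number of walks through it is unchanged.\<close>

lemma swap_tails_properties:
  assumes P: "P \<in> walk_tuples k s t" and ij: "i < k" "j < k" "i \<noteq> j"
    and x: "x \<in> set (awalk_verts (s i) (P i))" "x \<in> set (awalk_verts (s j) (P j))"
  defines "P' \<equiv> swap_tails s x i j P"
  shows "P' \<in> walk_tuples k s (t \<circ> Transposition.transpose i j)"
    and "swap_tails s x i j P' = P"
    and "meeting_walks k s P' x = meeting_walks k s P x"
    and "common_vertices k s P' = common_vertices k s P"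
    and "(\<Prod>a=0..<k. prod_list (map w (P' a))) = (\<Prod>a=0..<k. prod_list (map w (P a)) :: 'c :: comm_monoid_mult)"
proof -
  have walk: "awalk (s a) (P a) (t a)" if "a < k" for a
    using P that by (auto simp: walk_tuples_def PiE_iff)
  obtain Ai Bi where Pi: "P i = Ai @ Bi" "awalk (s i) Ai x" "awalk x Bi (t i)"
    using awalk_decomp[OF walk[OF ij(1)] x(1)] by blast
  obtain Aj Bj where Pj: "P j = Aj @ Bj" "awalk (s j) Aj x" "awalk x Bj (t j)"
    using awalk_decomp[OF walk[OF ij(2)] x(2)] by blast
  have P': "P' = P(i := Ai @ Bj, j := Aj @ Bi)"
    using ij Pi Pj by (simp add: P'_def swap_tails_def walk_to_append walk_from_append)
  show "P' \<in> walk_tuples k s (t \<circ> Transposition.transpose i j)"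
    using P ij Pi Pj unfolding P'
    by (auto simp: walk_tuples_def PiE_iff extensional_def Transposition.transpose_def
        intro: awalk_appendI)
  show "swap_tails s x i j P' = P"
    using ij Pi Pj by (auto simp: P' swap_tails_def walk_to_append walk_from_append fun_eq_iff)
  define V V' where "V = (\<lambda>a. set (awalk_verts (s a) (P a)))"
    and "V' = (\<lambda>a. set (awalk_verts (s a) (P' a)))"
  define A B where "A = (\<lambda>a. set (awalk_verts (s a) (if a = i then Ai else Aj)))"
    and "B = (\<lambda>a. set (awalk_verts x (if a = i then Bi else Bj)))"
  have V: "V i = A i \<union> B i" "V j = A j \<union> B j"
    using Pi Pj ij by (auto simp: V_def A_def B_def set_awalk_verts_append)
  have V': "V' i = A i \<union> B j" "V' j = A j \<union> B i"
    using Pi Pj ij by (auto simp: V'_def P' A_def B_def set_awalk_verts_append)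
  have V'_other: "V' a = V a" if "a \<noteq> i" "a \<noteq> j" for a
    using that by (simp add: V_def V'_def P')
  have x_in: "x \<in> B i" "x \<in> B j"
    using Pi Pj ij hd_in_awalk_verts(1) by (auto simp: B_def dest: hd_in_awalk_verts)
  have AB: "y = x" if "y \<in> A i" "y \<in> B i" for y
    using walks_through_meet_once[OF Pi(2,3)] that by (simp add: A_def B_def)
  have AB': "y = x" if "y \<in> A j" "y \<in> B j" for y
    using walks_through_meet_once[OF Pj(2,3)] that ij by (simp add: A_def B_def)
  have AB'': "y = x" if "y \<in> A i" "y \<in> B j" for y
    using walks_through_meet_once[OF Pi(2) Pj(3)] that ij by (simp add: A_def B_def)
  have ABx: "y = x" if "y \<in> A j" "y \<in> B i" for y
    using walks_through_meet_once[OF Pj(2) Pi(3)] that ij by (simp add: A_def B_def)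
  show "meeting_walks k s P' x = meeting_walks k s P x"
  proof -
    have "x \<in> V' a \<longleftrightarrow> x \<in> V a" for a
      using V V' V'_other[of a] x_in by (cases "a = i"; cases "a = j") auto
    then show ?thesis by (simp add: meeting_walks_def V_def V'_def)
  qed
  show "common_vertices k s P' = common_vertices k s P"
  proof -
    \<comment> \<open>The existence of two distinct indices with a property is unaffected by
      exchanging \<open>i\<close> and \<open>j\<close>.\<close>
    have transfer: "\<exists>a<k. \<exists>b<k. a \<noteq> b \<and> R a \<and> R b"
      if ex: "\<exists>a<k. \<exists>b<k. a \<noteq> b \<and> Q a \<and> Q b"
        and alt: "(\<forall>a. Q a = R a) \<or> (\<forall>a. Q a = R (Transposition.transpose i j a))"
      for Q R :: "nat \<Rightarrow> bool"
    proof -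
      obtain a b where ab: "a < k" "b < k" "a \<noteq> b" "Q a" "Q b" using ex by blast
      let ?t = "Transposition.transpose i j"
      have "?t a < k" "?t b < k" "?t a \<noteq> ?t b"
        using ab ij by (auto simp: Transposition.transpose_def)
      then show ?thesis using ab alt by metis
    qed
    have "(\<exists>a<k. \<exists>b<k. a \<noteq> b \<and> y \<in> V' a \<and> y \<in> V' b) \<longleftrightarrow>
          (\<exists>a<k. \<exists>b<k. a \<noteq> b \<and> y \<in> V a \<and> y \<in> V b)" for y
    proof -
      have "(\<forall>a. (y \<in> V' a) = (y \<in> V a)) \<or>
            (\<forall>a. (y \<in> V' a) = (y \<in> V (Transposition.transpose i j a)))"
      proof (cases "y = x \<or> y \<in> A i \<or> y \<in> A j")
        case True
        then have "y = x \<or> (y \<notin> B i \<and> y \<notin> B j)"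
          using AB AB' AB'' ABx by blast
        then have "(y \<in> V' a) = (y \<in> V a)" for a
          using x_in by (cases "a = i"; cases "a = j") (auto simp: V V' V'_other)
        then show ?thesis by blast
      next
        case False
        then have "(y \<in> V' a) = (y \<in> V (Transposition.transpose i j a))" for a
          using ij by (cases "a = i"; cases "a = j") (auto simp: V V' V'_other)
        then show ?thesis by blast
      qed
      note alt = this
      have "(\<forall>a. (y \<in> V a) = (y \<in> V' a)) \<or>
            (\<forall>a. (y \<in> V a) = (y \<in> V' (Transposition.transpose i j a)))"
        using alt
      proof
        assume *: "\<forall>a. (y \<in> V' a) = (y \<in> V (Transposition.transpose i j a))"
        have "(y \<in> V a) = (y \<in> V' (Transposition.transpose i j a))" for a
          using *[rule_format, of "Transposition.transpose i j a"] by simp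
        then show ?thesis by blast
      qed simp
      from transfer[OF _ alt] transfer[OF _ this] show ?thesis by (rule iffI)
    qed
    then show ?thesis
      unfolding common_vertices_def V_def V'_def by (intro Collect_cong)
  qed
  show "(\<Prod>a=0..<k. prod_list (map w (P' a))) = (\<Prod>a=0..<k. prod_list (map w (P a)))"
  proof -
    have split: "(\<Prod>a=0..<k. f a) = f i * (f j * (\<Prod>a\<in>{0..<k} - {i} - {j}. f a))"
      for f :: "nat \<Rightarrow> 'c"
      using ij by (subst prod.remove[of _ i], simp, simp, subst prod.remove[of _ j]) auto
    have "(\<Prod>a\<in>{0..<k} - {i} - {j}. prod_list (map w (P' a))) =
          (\<Prod>a\<in>{0..<k} - {i} - {j}. prod_list (map w (P a)))"
      by (rule prod.cong) (auto simp: P')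
    then show ?thesis
      unfolding split using ij by (simp add: P' Pi(1) Pj(1) mult_ac)
  qed
qed

text \<open>
  The choice depends only on data that are invariant under the exchange of the tails, so that the
  exchange is an involution.
\<close>

definition swap_data :: "nat \<Rightarrow> (nat \<Rightarrow> 'a) \<Rightarrow> (nat \<Rightarrow> 'b list) \<Rightarrow> 'a \<times> nat \<times> nat" where
  "swap_data k s P =
     (let x = SOME x. x \<in> common_vertices k s P;
          i = Min (meeting_walks k s P x);
          j = Min (meeting_walks k s P x - {i})
      in (x, i, j))"

lemma swap_data_properties:
  assumes "common_vertices k s P \<noteq> {}" "swap_data k s P = (x, i, j)"
  shows "i < k" "j < k" "i \<noteq> j" "x \<in> set (awalk_verts (s i) (P i))"
    "x \<in> set (awalk_verts (s j) (P j))"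
proof -
  define M where "M = meeting_walks k s P x"
  have xij: "x = (SOME x. x \<in> common_vertices k s P)" "i = Min M" "j = Min (M - {i})"
    using assms(2) by (auto simp: swap_data_def Let_def M_def)
  have "x \<in> common_vertices k s P"
    using assms(1) xij(1) some_in_eq by blast
  then obtain a b where ab: "a \<in> M" "b \<in> M" "a \<noteq> b"
    by (auto simp: common_vertices_def M_def meeting_walks_def)
  have fin: "finite M" by (simp add: M_def meeting_walks_def)
  have "i \<in> M" unfolding xij using ab fin by (intro Min_in) auto
  moreover have "j \<in> M - {i}" unfolding xij(3) using ab fin by (intro Min_in) auto
  ultimately show "i < k" "j < k" "i \<noteq> j" "x \<in> set (awalk_verts (s i) (P i))"
    "x \<in> set (awalk_verts (s j) (P j))"
    by (auto simp: M_def meeting_walks_def)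
qed

text \<open>The exchange of tails, paired with a transposition of the target permutation, is an
  involution that keeps the weight and reverses the sign. So the sum equals its own negative, and in
  characteristic 0 it vanishes.\<close>

lemma intersecting_tuples_cancel:
  fixes w :: "'b \<Rightarrow> 'c :: field_char_0"
  shows "(\<Sum>(p, P) \<in> (SIGMA p:{p. p permutes {0..<k}}.
           {P \<in> walk_tuples k s (t \<circ> p). common_vertices k s P \<noteq> {}}).
         of_int (sign p) * (\<Prod>i=0..<k. prod_list (map w (P i)))) = 0"
    (is "sum ?f ?X = 0")
proof -
  define \<phi> where "\<phi> = (\<lambda>(p :: nat \<Rightarrow> nat, P).
    case swap_data k s P of (x, i, j) \<Rightarrow> (p \<circ> Transposition.transpose i j, swap_tails s x i j P))"
  have main: "\<phi> y \<in> ?X \<and> \<phi> (\<phi> y) = y \<and> ?f (\<phi> y) = - ?f y" if "y \<in> ?X" for y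
  proof -
    obtain p P where y: "y = (p, P)" by (cases y)
    then have p: "p permutes {0..<k}" and P: "P \<in> walk_tuples k s (t \<circ> p)"
      and ne: "common_vertices k s P \<noteq> {}"
      using that by auto
    obtain x i j where d: "swap_data k s P = (x, i, j)" by (metis prod_cases3)
    note ij = swap_data_properties[OF ne d]
    define P' where "P' = swap_tails s x i j P"
    note sw = swap_tails_properties[OF P ij, folded P'_def]
    have \<phi>y: "\<phi> y = (p \<circ> Transposition.transpose i j, P')"
      by (simp add: \<phi>_def y d P'_def)
    have tr: "Transposition.transpose i j permutes {0..<k}"
      using ij by (intro permutes_swap_id) auto
    have "swap_data k s P' = (x, i, j)"
      using d sw(3,4) by (auto simp: swap_data_def Let_def)
    then have "\<phi> (\<phi> y) = y"
      unfolding \<phi>y by (simp add: \<phi>_def y sw(2) comp_assoc)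
    moreover have "\<phi> y \<in> ?X"
      using sw(1,4) ne permutes_compose[OF tr p] by (simp add: \<phi>y comp_assoc)
    moreover have "sign (p \<circ> Transposition.transpose i j) = - sign p"
      using ij p by (subst sign_compose)
        (auto simp: sign_swap_id permutation_swap_id intro: permutes_imp_permutation[of "{0..<k}"])
    then have "?f (\<phi> y) = - ?f y"
      unfolding \<phi>y by (simp add: y sw(5))
    ultimately show ?thesis by blast
  qed
  have "sum ?f ?X = sum (\<lambda>y. - ?f y) ?X"
    by (rule sum.reindex_bij_witness[of _ \<phi> \<phi>]) (use main in \<open>auto simp del: split_paired_All\<close>)
  also have "\<dots> = - sum ?f ?X"
    by (rule sum_negf)
  finally have "sum ?f ?X = - sum ?f ?X" .
  moreover have "x = 0" if "x = - x" for x :: 'c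
  proof -
    have "2 * x = x + x" by (rule mult_2)
    also have "\<dots> = 0" using that by (metis add.right_inverse)
    finally show ?thesis by simp
  qed
  ultimately show ?thesis by blast
qed

text \<open>Expanding the products of sums in the Leibniz formula turns the determinant into a
  signed sum over all pairs of a permutation and a walk tuple; the intersecting ones cancel.\<close>

lemma lindstroem_gessel_viennot:
  fixes w :: "'b \<Rightarrow> 'c :: field_char_0"
  shows "Determinant.det (mat k k (\<lambda>(i, j). \<Sum>q | awalk (s i) q (t j). prod_list (map w q))) =
    (\<Sum>p | p permutes {0..<k}. of_int (sign p) *
       (\<Sum>P | P \<in> walk_tuples k s (t \<circ> p) \<and> common_vertices k s P = {}.
          \<Prod>i=0..<k. prod_list (map w (P i))))"
proof -
  define perms where "perms = {p. p permutes {0..<k}}"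
  define wt where "wt = (\<lambda>P. \<Prod>i=0..<k. prod_list (map w (P i)))"
  have fin: "finite perms" by (simp add: perms_def finite_permutations)
  have split: "sum wt W = sum wt {P \<in> W. Q P} + sum wt {P \<in> W. \<not> Q P}" if "finite W" for W Q
  proof -
    have "W = {P \<in> W. Q P} \<union> {P \<in> W. \<not> Q P}" by blast
    then show ?thesis
      using that by (subst sum.union_disjoint[symmetric]) auto
  qed
  have "Determinant.det (mat k k (\<lambda>(i, j). \<Sum>q | awalk (s i) q (t j). prod_list (map w q))) =
    (\<Sum>p\<in>perms. of_int (sign p) * (\<Prod>i=0..<k. \<Sum>q | awalk (s i) q (t (p i)). prod_list (map w q)))"
    unfolding perms_def
    by (subst det_def'[of _ k])
      (auto intro!: sum.cong prod.cong dest: permutes_in_image[of _ "{0..<k}"])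
  also have "\<dots> = (\<Sum>p\<in>perms. of_int (sign p) * sum wt (walk_tuples k s (t \<circ> p)))"
    by (subst prod_sum_PiE) (simp_all add: finite_awalks walk_tuples_def wt_def)
  also have "\<dots> = (\<Sum>p\<in>perms. of_int (sign p) *
        sum wt {P \<in> walk_tuples k s (t \<circ> p). common_vertices k s P = {}}) +
     (\<Sum>p\<in>perms. of_int (sign p) *
        sum wt {P \<in> walk_tuples k s (t \<circ> p). common_vertices k s P \<noteq> {}})"
    unfolding sum.distrib[symmetric] distrib_left[symmetric]
    by (intro sum.cong refl arg_cong2[where f = "(*)"] split finite_walk_tuples)
  also have "(\<Sum>p\<in>perms. of_int (sign p) *
        sum wt {P \<in> walk_tuples k s (t \<circ> p). common_vertices k s P \<noteq> {}}) =
     (\<Sum>(p, P) \<in> (SIGMA p:perms.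
           {P \<in> walk_tuples k s (t \<circ> p). common_vertices k s P \<noteq> {}}). of_int (sign p) * wt P)"
    unfolding sum_distrib_left using fin
    by (subst sum.Sigma) (auto simp: finite_walk_tuples)
  also have "\<dots> = 0"
    unfolding perms_def wt_def by (rule intersecting_tuples_cancel)
  finally show ?thesis
    by (simp only: perms_def wt_def add_0_right)
qed

text \<open>A non-intersecting tuple forces its permutation to be increasing, so that only the
  identity, with sign 1, contributes.\<close>

lemma lindstroem_gessel_viennot_ordered:
  fixes w :: "'b \<Rightarrow> 'c :: field_char_0"
  assumes "\<And>i j a b q r. \<lbrakk>i < j; j < k; a < k; b < k; awalk (s i) q (t a); awalk (s j) r (t b);
      set (awalk_verts (s i) q) \<inter> set (awalk_verts (s j) r) = {}\<rbrakk> \<Longrightarrow> a < b"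
  shows "Determinant.det (mat k k (\<lambda>(i, j). \<Sum>q | awalk (s i) q (t j). prod_list (map w q))) =
    (\<Sum>P | P \<in> walk_tuples k s t \<and> common_vertices k s P = {}. \<Prod>i=0..<k. prod_list (map w (P i)))"
proof -
  have none: "{P. P \<in> walk_tuples k s (t \<circ> p) \<and> common_vertices k s P = {}} = {}"
    if p: "p permutes {0..<k}" "p \<noteq> id" for p
  proof (rule ccontr)
    assume "\<not> ?thesis"
    then obtain P where P: "P \<in> walk_tuples k s (t \<circ> p)" "common_vertices k s P = {}" by blast
    have lt: "p i < k" if "i < k" for i
      using permutes_in_image[OF p(1)] that by simp
    have mono: "p i < p j" if "i < j" "j < k" for i j
    proof (rule assms)
      show "awalk (s i) (P i) (t (p i))" "awalk (s j) (P j) (t (p j))"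
        using that P(1) by (auto simp: walk_tuples_def PiE_iff)
      have "x \<notin> common_vertices k s P" for x using P(2) by blast
      then show "set (awalk_verts (s i) (P i)) \<inter> set (awalk_verts (s j) (P j)) = {}"
        using that unfolding common_vertices_def by fastforce
    qed (use that lt in auto)
    \<comment> \<open>An increasing function on an initial segment of the naturals lies above the
      identity, and the identity is the only permutation that does.\<close>
    have "i \<le> p i" if "i < k" for i
      using that
    proof (induction i)
      case (Suc i)
      then show ?case using mono[of i "Suc i"] by simp
    qed simp
    then have "\<forall>i\<in>{0..<k}. p i \<ge> i" by simp
    then have "p = id" using p(1) permutes_natset_ge by blast
    with p(2) show False ..
  qed
  have "(\<Sum>p | p permutes {0..<k}. of_int (sign p) *
       (\<Sum>P | P \<in> walk_tuples k s (t \<circ> p) \<and> common_vertices k s P = {}.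
          \<Prod>i=0..<k. prod_list (map w (P i)))) =
     (\<Sum>p | p permutes {0..<k}. if p = id then
       (\<Sum>P | P \<in> walk_tuples k s t \<and> common_vertices k s P = {}.
          \<Prod>i=0..<k. prod_list (map w (P i))) else 0)"
  proof (intro sum.cong refl)
    fix p :: "nat \<Rightarrow> nat"
    assume p: "p \<in> {p. p permutes {0..<k}}"
    show "of_int (sign p) *
       (\<Sum>P | P \<in> walk_tuples k s (t \<circ> p) \<and> common_vertices k s P = {}.
          \<Prod>i=0..<k. prod_list (map w (P i))) = (if p = id then
       (\<Sum>P | P \<in> walk_tuples k s t \<and> common_vertices k s P = {}.
          \<Prod>i=0..<k. prod_list (map w (P i))) else 0)"
    proof (cases "p = id")
      case False
      have "{P. P \<in> walk_tuples k s (t \<circ> p) \<and> common_vertices k s P = {}} = {}"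
        using none p False by blast
      with False show ?thesis by (simp only: sum.empty mult_zero_right if_False)
    qed (simp add: sign_id)
  qed
  also have "\<dots> = (\<Sum>P | P \<in> walk_tuples k s t \<and> common_vertices k s P = {}.
          \<Prod>i=0..<k. prod_list (map w (P i)))"
    by (subst sum.delta) (auto simp: finite_permutations permutes_id)
  finally show ?thesis
    by (simp only: lindstroem_gessel_viennot)
qed

end

section \<open>Gluing\<close>

text \<open>These conditions form the induction hypothesis for the powers: gluing reproduces all of
  them, see \<open>glued_ordered\<close>.\<close>

locale ordered_network = acyclic_digraph "dgraph N" for N :: "('v, 'e) network" +
  assumes sources_in_verts: "sources N \<subseteq> verts (dgraph N)"
    and sinks_in_verts: "sinks N \<subseteq> verts (dgraph N)"
    and no_arc_from_sink: "e \<in> arcs (dgraph N) \<Longrightarrow> tail (dgraph N) e \<notin> sinks N"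
    and inj_source: "inj_on (source N) {1..num N}"
    and inj_sink: "inj_on (sink N) {1..num N}"
    and order_preserving: "order_preserving N"

lemma planar_network_ordered:
  assumes "planar_network N" "acyclic_network N"
  shows "ordered_network N"
proof -
  interpret fin_digraph "dgraph N" by (rule planar_networkD(1)[OF assms(1)])
  show ?thesis
  proof
    fix u p assume "awalk u p u"
    then show "p = []"
      using assms(2) closed_w_imp_cycle[of p] unfolding acyclic_network_def closed_w_def by blast
  next
    fix e assume e: "e \<in> arcs (dgraph N)"
    show "tail (dgraph N) e \<notin> sinks N"
    proof
      assume "tail (dgraph N) e \<in> sinks N"
      then have "card (out_arcs (dgraph N) (tail (dgraph N) e)) = 0"
        using planar_networkD(5)[OF assms(1)] by (simp add: out_degree_def)
      \<comment> \<open>Degrees are cardinalities, and \<open>card\<close> is 0 for infinite sets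
        too, so emptiness requires finiteness.\<close>
      moreover have "finite (out_arcs (dgraph N) (tail (dgraph N) e))"
        by (simp add: out_arcs_def)
      ultimately have "out_arcs (dgraph N) (tail (dgraph N) e) = {}" by simp
      with e show False by (auto simp: out_arcs_def)
    qed
  qed (use planar_networkD[OF assms(1)] planar_network_inj[OF assms(1)]
        planar_network_order_preserving[OF assms(1)] in auto)
qed

lemma planar_network_no_arc_into_source:
  assumes "planar_network N" "e \<in> arcs (dgraph N)"
  shows "head (dgraph N) e \<notin> sources N"
proof
  interpret fin_digraph "dgraph N" by (rule planar_networkD(1)[OF assms(1)])
  assume "head (dgraph N) e \<in> sources N"
  then have "card (in_arcs (dgraph N) (head (dgraph N) e)) = 0"
    using planar_networkD(4)[OF assms(1)] by (simp add: in_degree_def)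
  moreover have "finite (in_arcs (dgraph N) (head (dgraph N) e))"
    by (simp add: in_arcs_def)
  ultimately have "in_arcs (dgraph N) (head (dgraph N) e) = {}" by simp
  with assms(2) show False by (auto simp: in_arcs_def)
qed

text \<open>All tags in \<open>H\<close> lie below \<open>k\<close>, so the copy with tag
  \<open>k\<close> shares with \<open>H\<close> only the glued vertices.\<close>

locale gluing = N: ordered_network N + H: ordered_network H
  for N :: "('v, 'e) network" and H :: "(nat \<times> 'v, nat \<times> 'e) network" +
  fixes k :: nat
  assumes no_arc_into_source: "e \<in> arcs (dgraph N) \<Longrightarrow> head (dgraph N) e \<notin> sources N"
    and disjoint_ends: "sources N \<inter> sinks N = {}"
    and num_eq: "num H = num N"
    and old_verts: "v \<in> verts (dgraph H) \<Longrightarrow> fst v < k"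
    and old_arcs: "a \<in> arcs (dgraph H) \<Longrightarrow> fst a < k"
begin

abbreviation glued :: "(nat \<times> 'v, nat \<times> 'e) network" where
  "glued \<equiv> append_copy N k H"

abbreviation cv :: "'v \<Rightarrow> nat \<times> 'v" where
  "cv \<equiv> copy_vertex N k H"

lemma cv_source: "l \<in> {1..num N} \<Longrightarrow> cv (source N l) = sink H l"
  using N.inj_source by (simp add: copy_vertex_def inv_into_f_f)

lemma cv_other: "v \<notin> sources N \<Longrightarrow> cv v = (k, v)"
  by (simp add: copy_vertex_def)

lemma sink_H_old: "l \<in> {1..num N} \<Longrightarrow> sink H l \<in> verts (dgraph H)"
  using H.sinks_in_verts num_eq by auto

lemma cv_old_iff: "cv v \<in> verts (dgraph H) \<longleftrightarrow> v \<in> sources N"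
proof (cases "v \<in> sources N")
  case True
  then show ?thesis using cv_source sink_H_old by auto
next
  case False
  then show ?thesis using cv_other old_verts by fastforce
qed

lemma cv_inj: "cv v = cv w \<Longrightarrow> v = w"
proof -
  assume eq: "cv v = cv w"
  then have iff: "v \<in> sources N \<longleftrightarrow> w \<in> sources N"
    using cv_old_iff by metis
  show "v = w"
  proof (cases "v \<in> sources N")
    case True
    then obtain l l' where l: "l \<in> {1..num N}" "l' \<in> {1..num N}" "v = source N l" "w = source N l'"
      using iff by blast
    then have "sink H l = sink H l'" using eq by (simp add: cv_source)
    then have "l = l'" using H.inj_sink l num_eq by (auto dest: inj_onD)
    with l show ?thesis by simp
  next
    case False
    then show ?thesis using eq iff by (simp add: cv_other)
  qed
qed

lemma glued_simps:
  "verts (dgraph glued) = verts (dgraph H) \<union> cv ` verts (dgraph N)"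
  "arcs (dgraph glued) = arcs (dgraph H) \<union> Pair k ` arcs (dgraph N)"
  "tail (dgraph glued) (k, e) = cv (tail (dgraph N) e)"
  "head (dgraph glued) (k, e) = cv (head (dgraph N) e)"
  "num glued = num N" "source glued = source H" "sink glued = (\<lambda>i. cv (sink N i))"
  "weight glued (k, e) = weight N e"
  by (simp_all add: append_copy_def)

lemma glued_old_arc:
  assumes "a \<in> arcs (dgraph H)"
  shows "tail (dgraph glued) a = tail (dgraph H) a" "head (dgraph glued) a = head (dgraph H) a"
    "weight glued a = weight H a"
  using old_arcs[OF assms] by (auto simp: append_copy_def split: prod.splits)

sublocale glued: fin_digraph "dgraph glued"
proof
  fix a assume "a \<in> arcs (dgraph glued)"
  then consider "a \<in> arcs (dgraph H)" | e where "e \<in> arcs (dgraph N)" "a = (k, e)"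
    by (auto simp: glued_simps)
  then show "tail (dgraph glued) a \<in> verts (dgraph glued)" "head (dgraph glued) a \<in> verts (dgraph glued)"
    using H.tail_in_verts H.head_in_verts by (cases; auto simp: glued_old_arc glued_simps)+
qed (auto simp: glued_simps)

lemma copy_walk:
  assumes "N.awalk w q w'"
  shows "glued.awalk (cv w) (map (Pair k) q) (cv w')"
    and "glued.awalk_verts (cv w) (map (Pair k) q) = map cv (N.awalk_verts w q)"
  using assms
  by (induction q arbitrary: w) (auto simp: N.awalk_simps glued.awalk_simps glued_simps)

text \<open>A walk that has entered the copy never leaves it: the only vertices shared with
  \<open>H\<close> are sinks of \<open>H\<close>, and no arc of \<open>H\<close> starts
  there.\<close>

lemma walk_from_copy:
  assumes "w \<in> verts (dgraph N)" "glued.awalk (cv w) p x"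
  obtains q w' where "p = map (Pair k) q" "N.awalk w q w'" "x = cv w'"
proof -
  have "\<exists>q w'. p = map (Pair k) q \<and> N.awalk w q w' \<and> x = cv w'"
    using assms
  proof (induction p arbitrary: w)
    case Nil
    then show ?case
      by (intro exI[of _ "[]"] exI[of _ w]) (auto simp: glued.awalk_simps N.awalk_simps)
  next
    case (Cons a p)
    then have a: "a \<in> arcs (dgraph glued)" "cv w = tail (dgraph glued) a"
      "glued.awalk (head (dgraph glued) a) p x"
      by (auto simp: glued.awalk_Cons_iff)
    have "a \<notin> arcs (dgraph H)"
    proof
      assume old: "a \<in> arcs (dgraph H)"
      then have tl: "cv w = tail (dgraph H) a" using a(2) glued_old_arc by simp
      then have "w \<in> sources N" using H.tail_in_verts[OF old] cv_old_iff by metis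
      then obtain l where "l \<in> {1..num N}" "w = source N l" by blast
      then have "cv w \<in> sinks H" using cv_source num_eq by auto
      then show False using H.no_arc_from_sink[OF old] tl by simp
    qed
    then obtain e where e: "e \<in> arcs (dgraph N)" "a = (k, e)"
      using a(1) by (auto simp: glued_simps)
    then have "w = tail (dgraph N) e" using a(2) cv_inj by (simp add: glued_simps)
    have "glued.awalk (cv (head (dgraph N) e)) p x"
      using a(3) e(2) by (simp add: glued_simps)
    from Cons.IH[OF N.head_in_verts[OF e(1)] this]
    obtain q w' where "p = map (Pair k) q" "N.awalk (head (dgraph N) e) q w'" "x = cv w'" by blast
    then show ?case
      using e \<open>w = _\<close> by (intro exI[of _ "e # q"] exI[of _ w']) (auto simp: N.awalk_Cons_iff)
  qed
  then show ?thesis using that by blast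
qed

lemma old_walk:
  assumes "H.awalk u p x"
  shows "glued.awalk u p x" and "glued.awalk_verts u p = H.awalk_verts u p"
  using assms
  by (induction p arbitrary: u)
    (auto simp: H.awalk_simps glued.awalk_simps glued_old_arc, auto simp: glued_simps)

text \<open>The first arc with tag \<open>k\<close> starts at a vertex of \<open>H\<close>, hence at
  a glued one; from there on \<open>walk_from_copy\<close> applies. This is the cut at the gluing
  line.\<close>

lemma walk_from_old:
  assumes "u \<in> verts (dgraph H)" "glued.awalk u p x"
  shows "H.awalk u p x \<or> (\<exists>l p1 q w. l \<in> {1..num N} \<and> p = p1 @ map (Pair k) q \<and>
    H.awalk u p1 (sink H l) \<and> N.awalk (source N l) q w \<and> x = cv w)"
  using assms
proof (induction p arbitrary: u)
  case Nil
  then show ?case by (simp add: glued.awalk_simps H.awalk_simps)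
next
  case (Cons a p)
  then have a: "a \<in> arcs (dgraph glued)" "u = tail (dgraph glued) a"
    "glued.awalk (head (dgraph glued) a) p x"
    by (auto simp: glued.awalk_Cons_iff)
  show ?case
  proof (cases "a \<in> arcs (dgraph H)")
    case True
    then have u: "u = tail (dgraph H) a" and "glued.awalk (head (dgraph H) a) p x"
      using a glued_old_arc by auto
    from Cons.IH[OF H.head_in_verts[OF True] this(2)] show ?thesis
    proof (elim disjE exE conjE)
      assume "H.awalk (head (dgraph H) a) p x"
      then show ?thesis using True u by (simp add: H.awalk_Cons_iff)
    next
      fix l p1 q w
      assume "l \<in> {1..num N}" "p = p1 @ map (Pair k) q" "H.awalk (head (dgraph H) a) p1 (sink H l)"
        "N.awalk (source N l) q w" "x = cv w"
      then show ?thesis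
        using True u
        by (intro disjI2 exI[of _ l] exI[of _ "a # p1"] exI[of _ q] exI[of _ w])
          (simp add: H.awalk_Cons_iff)
    qed
  next
    case False
    then obtain e where e: "e \<in> arcs (dgraph N)" "a = (k, e)"
      using a(1) by (auto simp: glued_simps)
    then have u: "u = cv (tail (dgraph N) e)" using a(2) by (simp add: glued_simps)
    with Cons.prems(1) obtain l where l: "l \<in> {1..num N}" "tail (dgraph N) e = source N l"
      using cv_old_iff by auto
    have "source N l \<in> verts (dgraph N)" using l N.sources_in_verts by blast
    moreover have "glued.awalk (cv (source N l)) (a # p) x"
      using Cons.prems(2) u l(2) by simp
    ultimately obtain q w where "a # p = map (Pair k) q" "N.awalk (source N l) q w" "x = cv w"
      by (rule walk_from_copy)
    moreover have "H.awalk u [] (sink H l)"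
      using Cons.prems(1) u l cv_source by (simp add: H.awalk_simps)
    ultimately show ?thesis using l(1)
      by (intro disjI2 exI[of _ l] exI[of _ "[]"] exI[of _ q] exI[of _ w]) simp
  qed
qed

lemma source_H_old: "i \<in> {1..num N} \<Longrightarrow> source H i \<in> verts (dgraph H)"
  using H.sources_in_verts num_eq by auto

text \<open>The path must cross the gluing line, because no sink of \<open>N\<close> is a source and
  so the sinks of the copy are new vertices.\<close>

lemma glued_path_cases:
  assumes "i \<in> {1..num N}" "j \<in> {1..num N}" "glued.awalk (source H i) p (cv (sink N j))"
  obtains l p1 q where "l \<in> {1..num N}" "p = p1 @ map (Pair k) q"
    "H.awalk (source H i) p1 (sink H l)" "N.awalk (source N l) q (sink N j)"
proof -
  have "\<not> H.awalk (source H i) p (cv (sink N j))"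
  proof
    assume "H.awalk (source H i) p (cv (sink N j))"
    then have "cv (sink N j) \<in> verts (dgraph H)" by (rule H.awalk_last_in_verts)
    then show False using assms(2) cv_old_iff disjoint_ends by blast
  qed
  then obtain l p1 q w where "l \<in> {1..num N}" "p = p1 @ map (Pair k) q"
    "H.awalk (source H i) p1 (sink H l)" "N.awalk (source N l) q w" "cv (sink N j) = cv w"
    using walk_from_old[OF source_H_old[OF assms(1)] assms(3)] by blast
  moreover from this(5) have "w = sink N j" using cv_inj by metis
  ultimately show ?thesis using that by blast
qed

lemma glued_path_concat:
  assumes "l \<in> {1..num N}" "H.awalk u p (sink H l)" "N.awalk (source N l) q w"
  shows "glued.awalk u (p @ map (Pair k) q) (cv w)"
    and "set (glued.awalk_verts u (p @ map (Pair k) q)) =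
      set (H.awalk_verts u p) \<union> cv ` set (N.awalk_verts (source N l) q)"
proof -
  have 1: "glued.awalk u p (sink H l)" "glued.awalk (sink H l) (map (Pair k) q) (cv w)"
    using old_walk(1)[OF assms(2)] copy_walk(1)[OF assms(3)] cv_source[OF assms(1)] by simp_all
  then show "glued.awalk u (p @ map (Pair k) q) (cv w)" by (rule glued.awalk_appendI)
  have "glued.awalk_verts (sink H l) (map (Pair k) q) = map cv (N.awalk_verts (source N l) q)"
    using copy_walk(2)[OF assms(3)] cv_source[OF assms(1)] by simp
  then show "set (glued.awalk_verts u (p @ map (Pair k) q)) =
      set (H.awalk_verts u p) \<union> cv ` set (N.awalk_verts (source N l) q)"
    unfolding glued.set_awalk_verts_append[OF 1] old_walk(2)[OF assms(2)] by simp
qed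

text \<open>Disjoint paths have disjoint pieces. The pieces in \<open>H\<close> order the two
  crossing points, and the pieces in the copy carry this order on to the sinks.\<close>

lemma glued_order_preserving: "order_preserving glued"
  unfolding order_preserving_def paths_def mem_Collect_eq glued_simps
proof (intro allI impI)
  fix i j a b p q
  assume ij: "1 \<le> i" "i < j" "j \<le> num N" and ab: "a \<in> {1..num N}" "b \<in> {1..num N}"
    and p: "glued.awalk (source H i) p (cv (sink N a))"
    and q: "glued.awalk (source H j) q (cv (sink N b))"
    and disj: "set (glued.awalk_verts (source H i) p) \<inter> set (glued.awalk_verts (source H j) q) = {}"
  have i: "i \<in> {1..num N}" "j \<in> {1..num N}" using ij by auto
  obtain l p1 p2 where P: "l \<in> {1..num N}" "p = p1 @ map (Pair k) p2"
    "H.awalk (source H i) p1 (sink H l)" "N.awalk (source N l) p2 (sink N a)"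
    using glued_path_cases[OF i(1) ab(1) p] by blast
  obtain l' q1 q2 where Q: "l' \<in> {1..num N}" "q = q1 @ map (Pair k) q2"
    "H.awalk (source H j) q1 (sink H l')" "N.awalk (source N l') q2 (sink N b)"
    using glued_path_cases[OF i(2) ab(2) q] by blast
  have disj': "set (H.awalk_verts (source H i) p1) \<inter> set (H.awalk_verts (source H j) q1) = {}"
    "set (N.awalk_verts (source N l) p2) \<inter> set (N.awalk_verts (source N l') q2) = {}"
    using disj unfolding P(2) Q(2) glued_path_concat(2)[OF P(1,3,4)] glued_path_concat(2)[OF Q(1,3,4)]
    by blast+
  have "l < l'"
    using H.order_preserving ij P(1,3) Q(1,3) disj'(1)
    unfolding order_preserving_def paths_def mem_Collect_eq num_eq by blast
  then show "a < b"
    using N.order_preserving ab P(1,4) Q(1,4) disj'(2)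
    unfolding order_preserving_def paths_def mem_Collect_eq by (metis atLeastAtMost_iff)
qed

lemma glued_ordered: "ordered_network glued"
proof
  fix u p assume walk: "glued.awalk u p u"
  show "p = []"
  \<comment> \<open>A closed walk cannot change sides: from a vertex of the copy it stays in the
    copy, and from any other vertex it would have to return there from the copy.\<close>
  proof (cases "u \<in> cv ` verts (dgraph N)")
    case True
    then obtain w where w: "w \<in> verts (dgraph N)" "u = cv w" by blast
    then obtain q w' where q: "p = map (Pair k) q" "N.awalk w q w'" "u = cv w'"
      using walk_from_copy[of w p u] walk by blast
    then have "w' = w" using w cv_inj by metis
    then have "q = []" using q N.no_closed_walk by blast
    then show ?thesis using q by simp
  next
    case False
    moreover have "u \<in> verts (dgraph glued)" using walk by (rule glued.awalk_last_in_verts)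
    ultimately have "u \<in> verts (dgraph H)" by (auto simp: glued_simps)
    from walk_from_old[OF this walk] show ?thesis
    proof (elim disjE exE conjE)
      assume "H.awalk u p u"
      then show ?thesis by (rule H.no_closed_walk)
    next
      fix l p1 q w assume "N.awalk (source N l) q w" "u = cv w"
      then show ?thesis using False N.awalk_last_in_verts by blast
    qed
  qed
next
  show "sources glued \<subseteq> verts (dgraph glued)"
    using source_H_old by (auto simp: glued_simps)
  show "sinks glued \<subseteq> verts (dgraph glued)"
    using N.sinks_in_verts by (auto simp: glued_simps)
  show "inj_on (source glued) {1..num glued}"
    using H.inj_source num_eq by (simp add: glued_simps)
  show "inj_on (sink glued) {1..num glued}"
  proof (rule inj_onI)
    fix i j assume "i \<in> {1..num glued}" "j \<in> {1..num glued}" "sink glued i = sink glued j"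
    then have "i \<in> {1..num N}" "j \<in> {1..num N}" "cv (sink N i) = cv (sink N j)"
      by (simp_all add: glued_simps)
    then show "i = j" using cv_inj inj_onD[OF N.inj_sink] by metis
  qed
next
  fix a assume a: "a \<in> arcs (dgraph glued)"
  show "tail (dgraph glued) a \<notin> sinks glued"
  proof
    assume "tail (dgraph glued) a \<in> sinks glued"
    then obtain j where j: "j \<in> {1..num N}" "tail (dgraph glued) a = cv (sink N j)"
      by (auto simp: glued_simps)
    from a consider "a \<in> arcs (dgraph H)" | e where "e \<in> arcs (dgraph N)" "a = (k, e)"
      by (auto simp: glued_simps)
    then show False
    proof cases
      case 1
      then have "cv (sink N j) \<in> verts (dgraph H)"
        using j H.tail_in_verts glued_old_arc by metis
      then show False using j disjoint_ends cv_old_iff by blast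
    next
      case 2
      then have "tail (dgraph N) e = sink N j"
        using j cv_inj by (simp add: glued_simps)
      then show False using N.no_arc_from_sink[OF 2(1)] j by blast
    qed
  qed
qed (rule glued_order_preserving)

text \<open>The cut of a glued path is unique: the tags recover both pieces, and the end of the
  first piece determines \<open>l\<close> as the sinks of \<open>H\<close> are distinct. Weights
  multiply along the cut.\<close>

lemma glued_path_weight_sum:
  assumes "i \<in> {1..num N}" "j \<in> {1..num N}"
  shows "(\<Sum>p\<in>paths glued (source glued i) (sink glued j). path_weight glued p) =
    (\<Sum>l\<in>{1..num N}. (\<Sum>p\<in>paths H (source H i) (sink H l). path_weight H p) *
       (\<Sum>q\<in>paths N (source N l) (sink N j). path_weight N q))"
proof -
  define T where "T = (SIGMA l:{1..num N}. paths H (source H i) (sink H l) \<times> paths N (source N l) (sink N j))"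
  define g :: "nat \<times> (nat \<times> 'e) list \<times> 'e list \<Rightarrow> (nat \<times> 'e) list"
    where "g = (\<lambda>(l, p, q). p @ map (Pair k) q)"
  have old: "\<forall>a\<in>set p. fst a \<noteq> k" if "H.awalk u p x" for u p x
    using that old_arcs by (auto elim!: H.awalkE')
  have "inj_on g T"
  proof (rule inj_onI)
    fix x y assume "x \<in> T" "y \<in> T" and eq: "g x = g y"
    then obtain l p q l' p' q' where x: "x = (l, p, q)" "l \<in> {1..num N}" "H.awalk (source H i) p (sink H l)"
      and y: "y = (l', p', q')" "l' \<in> {1..num N}" "H.awalk (source H i) p' (sink H l')"
      by (auto simp: T_def paths_def)
    have split: "filter (\<lambda>a. fst a \<noteq> k) (p @ map (Pair k) q) = p"
      "filter (\<lambda>a. fst a = k) (p @ map (Pair k) q) = map (Pair k) q"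
      if "H.awalk u p x" for u p x and q :: "'e list"
      using old[OF that] by (simp_all add: filter_empty_conv filter_id_conv)
    have eq': "p @ map (Pair k) q = p' @ map (Pair k) q'" using eq by (simp add: g_def x y)
    have "p = p'" using split(1)[OF x(3), of q] split(1)[OF y(3), of q'] eq' by simp
    moreover have "q = q'" using eq' \<open>p = p'\<close> by (simp add: inj_map_eq_map inj_def)
    moreover have "sink H l = sink H l'"
      using x(3) y(3) \<open>p = p'\<close> by (metis H.awalkE')
    then have "l = l'" using H.inj_sink x(2) y(2) num_eq by (auto dest: inj_onD)
    ultimately show "x = y" by (simp add: x y)
  qed
  moreover have "g ` T = paths glued (source glued i) (sink glued j)"
  proof (intro equalityI subsetI)
    fix p assume "p \<in> g ` T"
    then obtain l p1 q where "l \<in> {1..num N}" "p = p1 @ map (Pair k) q"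
      "H.awalk (source H i) p1 (sink H l)" "N.awalk (source N l) q (sink N j)"
      by (auto simp: T_def g_def paths_def)
    then show "p \<in> paths glued (source glued i) (sink glued j)"
      using glued_path_concat(1) by (simp add: paths_def glued_simps)
  next
    fix p assume "p \<in> paths glued (source glued i) (sink glued j)"
    then have "glued.awalk (source H i) p (cv (sink N j))" by (simp add: paths_def glued_simps)
    then obtain l p1 q where "l \<in> {1..num N}" "p = p1 @ map (Pair k) q"
      "H.awalk (source H i) p1 (sink H l)" "N.awalk (source N l) q (sink N j)"
      using glued_path_cases[OF assms] by blast
    then show "p \<in> g ` T"
      by (intro image_eqI[of _ _ "(l, p1, q)"]) (auto simp: T_def g_def paths_def)
  qed
  ultimately have "(\<Sum>p\<in>paths glued (source glued i) (sink glued j). path_weight glued p) =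
      (\<Sum>y\<in>T. path_weight glued (g y))"
    by (metis (no_types, lifting) sum.reindex_cong)
  also have "\<dots> = (\<Sum>(l, p, q)\<in>T. path_weight H p * path_weight N q)"
  proof (intro sum.cong refl)
    fix y assume "y \<in> T"
    then obtain l p q where y: "y = (l, p, q)" "H.awalk (source H i) p (sink H l)"
      by (auto simp: T_def paths_def)
    have eq: "map (weight glued) p = map (weight H) p"
      using y(2) glued_old_arc(3) by (auto elim!: H.awalkE')
    show "path_weight glued (g y) = (case y of (l, p, q) \<Rightarrow> path_weight H p * path_weight N q)"
      by (simp add: y g_def path_weight_def o_def glued_simps eq)
  qed
  also have "\<dots> = (\<Sum>l\<in>{1..num N}. \<Sum>(p, q)\<in>paths H (source H i) (sink H l) \<times> paths N (source N l) (sink N j).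
      path_weight H p * path_weight N q)"
    unfolding T_def by (subst sum.Sigma) (auto simp: paths_def H.finite_awalks N.finite_awalks)
  also have "\<dots> = (\<Sum>l\<in>{1..num N}. (\<Sum>p\<in>paths H (source H i) (sink H l). path_weight H p) *
       (\<Sum>q\<in>paths N (source N l) (sink N j). path_weight N q))"
    by (simp add: sum_product sum.cartesian_product)
  finally show ?thesis .
qed

lemma path_matrix_glued: "path_matrix glued = path_matrix H * path_matrix N"
proof (rule eq_matI)
  fix i j assume "i < dim_row (path_matrix H * path_matrix N)" "j < dim_col (path_matrix H * path_matrix N)"
  then have ij: "i < num N" "j < num N" by (auto simp: path_matrix_def num_eq)
  have "path_matrix glued $$ (i, j) =
      (\<Sum>l\<in>{1..num N}. (\<Sum>p\<in>paths H (source H (Suc i)) (sink H l). path_weight H p) *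
       (\<Sum>q\<in>paths N (source N l) (sink N (Suc j)). path_weight N q))"
    using ij glued_path_weight_sum[of "Suc i" "Suc j"] by (simp add: path_matrix_def glued_simps(5))
  also have "\<dots> = (\<Sum>l<num N. (\<Sum>p\<in>paths H (source H (Suc i)) (sink H (Suc l)). path_weight H p) *
       (\<Sum>q\<in>paths N (source N (Suc l)) (sink N (Suc j)). path_weight N q))"
    unfolding One_nat_def by (rule sum.atLeast1_atMost_eq)
  also have "\<dots> = (path_matrix H * path_matrix N) $$ (i, j)"
    using ij by (simp add: path_matrix_def num_eq scalar_prod_def atLeast0LessThan)
  finally show "path_matrix glued $$ (i, j) = (path_matrix H * path_matrix N) $$ (i, j)" .
qed (auto simp: path_matrix_def glued_simps(5) num_eq)

end

section \<open>Minors of the inverse matrix\<close>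

definition minor :: "'a :: comm_ring_1 mat \<Rightarrow> nat list \<Rightarrow> nat list \<Rightarrow> 'a" where
  "minor A xs ys = Determinant.det (mat (length xs) (length xs) (\<lambda>(i, j). A $$ (xs ! i, ys ! j)))"

definition complement_list :: "nat \<Rightarrow> nat list \<Rightarrow> nat list" where
  "complement_list n xs = filter (\<lambda>i. i \<notin> set xs) [0..<n]"

lemma set_complement_list: "set (complement_list n xs) = {0..<n} - set xs"
  by (auto simp: complement_list_def)

lemma sorted_complement_list: "sorted_wrt (<) (complement_list n xs)"
  unfolding complement_list_def by (intro sorted_wrt_filter) simp

lemma length_complement_list:
  assumes "sorted_wrt (<) xs" "set xs \<subseteq> {0..<n}"
  shows "length (complement_list n xs) = n - length xs"
proof -
  have "length (complement_list n xs) = card ({0..<n} - set xs)"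
    using distinct_card[of "complement_list n xs"] sorted_complement_list[of n xs]
    by (simp add: set_complement_list strict_sorted_iff)
  also have "\<dots> = n - length xs"
    using assms distinct_card[of xs] by (subst card_Diff_subset) (auto simp: strict_sorted_iff)
  finally show ?thesis .
qed

lemma strict_sorted_eqI:
  fixes xs ys :: "'a :: linorder list"
  assumes "sorted_wrt (<) xs" "sorted_wrt (<) ys" "set xs = set ys"
  shows "xs = ys"
  using assms by (simp add: strict_sorted_equal)

lemma complement_complement_list:
  assumes "sorted_wrt (<) xs" "set xs \<subseteq> {0..<n}"
  shows "complement_list n (complement_list n xs) = xs"
  using assms by (intro strict_sorted_eqI sorted_complement_list) (auto simp: set_complement_list)

lemma sum_list_complement_list:
  assumes "sorted_wrt (<) xs" "set xs \<subseteq> {0..<n}"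
  shows "sum_list xs + sum_list (complement_list n xs) = \<Sum>{0..<n}"
proof -
  have "sum_list ys = \<Sum>(set ys)" if "sorted_wrt (<) ys" for ys :: "nat list"
    using that sum.distinct_set_conv_list[of ys "\<lambda>x. x"] by (simp add: strict_sorted_iff)
  then have "sum_list xs + sum_list (complement_list n xs) = \<Sum>(set xs) + \<Sum>({0..<n} - set xs)"
    using assms(1) sorted_complement_list by (simp add: set_complement_list)
  also have "\<dots> = \<Sum>{0..<n}"
    using assms(2) sum.subset_diff[of "set xs" "{0..<n}" "\<lambda>x. x"] by simp
  finally show ?thesis .
qed

lemma minor_cong:
  assumes "length xs = length xs'" "length ys = length xs" "length ys' = length xs"
    and "\<And>i j. i < length xs \<Longrightarrow> j < length xs \<Longrightarrow> A $$ (xs ! i, ys ! j) = B $$ (xs' ! i, ys' ! j)"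
  shows "minor A xs ys = minor B xs' ys'"
  unfolding minor_def using assms by (intro arg_cong[where f = Determinant.det] cong_mat) auto

text \<open>This translates indices after the deletion of row or column \<open>r\<close> back to the
  original ones. The elements of \<open>xs\<close> lie below \<open>r\<close> and therefore keep
  their numbers under the deletion.\<close>

lemma map_insert_index_complement_list:
  assumes "\<forall>x\<in>set xs. x < r" "r \<le> n"
  shows "map (insert_index r) (complement_list n xs) = complement_list (Suc n) (xs @ [r])"
proof (rule strict_sorted_eqI)
  have mono: "insert_index r x < insert_index r y" if "x < y" for x y
    using that by (auto simp: insert_index_def)
  show "sorted_wrt (<) (map (insert_index r) (complement_list n xs))"
    unfolding sorted_wrt_map
    by (rule sorted_wrt_mono_rel[OF _ sorted_complement_list]) (rule mono)
  show "set (map (insert_index r) (complement_list n xs)) = set (complement_list (Suc n) (xs @ [r]))"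
  proof (intro equalityI subsetI)
    fix x assume "x \<in> set (map (insert_index r) (complement_list n xs))"
    then obtain y where "y < n" "y \<notin> set xs" "x = insert_index r y"
      by (auto simp: set_complement_list)
    then show "x \<in> set (complement_list (Suc n) (xs @ [r]))"
      using assms by (cases "y < r") (auto simp: set_complement_list)
  next
    fix x assume "x \<in> set (complement_list (Suc n) (xs @ [r]))"
    then have x: "x < Suc n" "x \<notin> set xs" "x \<noteq> r" by (auto simp: set_complement_list)
    then have "delete_index r x < n \<and> delete_index r x \<notin> set xs"
      using assms by (cases "x < r") (auto simp: delete_index_def)
    then have "delete_index r x \<in> set (complement_list n xs)"
      by (simp add: set_complement_list)
    then show "x \<in> set (map (insert_index r) (complement_list n xs))"
      using insert_delete_index[OF x(3)] by (metis image_eqI set_map)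
  qed
qed (rule sorted_complement_list)

text \<open>Laplace expansion along the listed rows, largest first. Deleting the largest listed row
  and column leaves the other listed indices unchanged, so each step contributes exactly the sign
  \<open>(-1) ^ (r + c)\<close>; hence the induction from the end of the list.\<close>

lemma det_unit_rows:
  fixes A :: "'a :: comm_ring_1 mat"
  assumes "A \<in> carrier_mat n n" "length rs = length cs"
    and "sorted_wrt (<) rs" "set rs \<subseteq> {0..<n}" "sorted_wrt (<) cs" "set cs \<subseteq> {0..<n}"
    and "\<And>i j. i < length rs \<Longrightarrow> j < n \<Longrightarrow> A $$ (rs ! i, j) = (if j = cs ! i then 1 else 0)"
  shows "Determinant.det A = (-1) ^ (sum_list rs + sum_list cs) *
    minor A (complement_list n rs) (complement_list n cs)"
  using assms
proof (induction rs arbitrary: A n cs rule: rev_induct)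
  case Nil
  then have "Matrix.mat n n (\<lambda>(i, j). A $$ ([0..<n] ! i, [0..<n] ! j)) = A"
    by (intro eq_matI) auto
  with Nil show ?case by (simp add: complement_list_def minor_def)
next
  case (snoc r rs)
  from snoc.prems(2) obtain cs' c where cs: "cs = cs' @ [c]"
    by (cases cs rule: rev_cases) auto
  with snoc.prems(2) have len: "length rs = length cs'" by simp
  obtain m where n: "n = Suc m" using snoc.prems(4) by (cases n) auto
  have rs: "sorted_wrt (<) rs" "\<forall>x\<in>set rs. x < r" "r \<le> m"
    and cs': "sorted_wrt (<) cs'" "\<forall>x\<in>set cs'. x < c" "c \<le> m"
    using snoc.prems(3-6) by (auto simp: sorted_wrt_append cs n)
  have sub: "set rs \<subseteq> {0..<m}" "set cs' \<subseteq> {0..<m}"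
    using rs cs' by force+
  define A' where "A' = mat_delete A r c"
  have A: "A \<in> carrier_mat (Suc m) (Suc m)" using snoc.prems(1) n by simp
  have A': "A' \<in> carrier_mat m m" unfolding A'_def using mat_delete_carrier[OF A] by simp
  have A'_index: "A' $$ (i, j) = A $$ (insert_index r i, insert_index c j)" if "i < m" "j < m" for i j
    unfolding A'_def using mat_delete_index[OF A, of r c i j] rs(3) cs'(3) that by simp
  have row: "A $$ (r, j) = (if j = c then 1 else 0)" if "j < n" for j
    using snoc.prems(7)[of "length rs" j] that len by (simp add: cs nth_append)
  have "Determinant.det A = (\<Sum>j<n. A $$ (r, j) * cofactor A r j)"
    using snoc.prems(1) rs(3) n by (intro laplace_expansion_row) auto
  also have "\<dots> = (\<Sum>j<n. if j = c then cofactor A r j else 0)"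
    using row by (intro sum.cong) auto
  also have "\<dots> = (-1) ^ (r + c) * Determinant.det A'"
    using cs'(3) n by (simp add: cofactor_def A'_def)
  also have "Determinant.det A' = (-1) ^ (sum_list rs + sum_list cs') *
      minor A' (complement_list m rs) (complement_list m cs')"
  proof (rule snoc.IH[OF A' len rs(1) sub(1) cs'(1) sub(2)])
    fix i j assume ij: "i < length rs" "j < m"
    then have "rs ! i \<in> set rs" "cs' ! i \<in> set cs'" using len by simp_all
    then have r: "rs ! i < r" "rs ! i < m" "cs' ! i < c"
      using rs(2) sub(1) cs'(2) by auto
    then have "A' $$ (rs ! i, j) = A $$ (rs ! i, insert_index c j)"
      using A'_index ij by simp
    also have "\<dots> = (if insert_index c j = cs' ! i then 1 else 0)"
      using snoc.prems(7)[of i "insert_index c j"] ij len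
      by (simp add: cs nth_append n insert_index_def)
    also have "insert_index c j = cs' ! i \<longleftrightarrow> j = cs' ! i"
      using r(3) by (auto simp: insert_index_def)
    finally show "A' $$ (rs ! i, j) = (if j = cs' ! i then 1 else 0)" .
  qed
  also have "minor A' (complement_list m rs) (complement_list m cs') =
      minor A (complement_list n (rs @ [r])) (complement_list n cs)"
  proof -
    have lens: "length (complement_list m cs') = length (complement_list m rs)"
      using length_complement_list[OF rs(1) sub(1)] length_complement_list[OF cs'(1) sub(2)] len by simp
    have "minor A' (complement_list m rs) (complement_list m cs') =
        minor A (map (insert_index r) (complement_list m rs)) (map (insert_index c) (complement_list m cs'))"
    proof (rule minor_cong)
      fix i j assume ij: "i < length (complement_list m rs)" "j < length (complement_list m rs)"
      then have "complement_list m rs ! i \<in> set (complement_list m rs)"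
        "complement_list m cs' ! j \<in> set (complement_list m cs')"
        using lens by simp_all
      then show "A' $$ (complement_list m rs ! i, complement_list m cs' ! j) =
        A $$ (map (insert_index r) (complement_list m rs) ! i, map (insert_index c) (complement_list m cs') ! j)"
        using ij lens A'_index by (simp add: set_complement_list)
    qed (use lens in simp_all)
    then show ?thesis
      using map_insert_index_complement_list[OF rs(2,3)] map_insert_index_complement_list[OF cs'(2,3)]
      by (simp add: cs n)
  qed
  finally show ?case
    by (simp add: cs power_add mult_ac)
qed

text \<open>Both \<open>M\<close> and \<open>M * A\<close> in the proof have enough unit rows for
  \<open>det_unit_rows\<close>. Up to sign, the first determinant is the minor of \<open>B\<close>
  and the second the complementary minor of \<open>A\<close>; their quotient is the determinant of
  \<open>A\<close>.\<close>

lemma jacobi_complementary_minor: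
  fixes A B :: "'a :: comm_ring_1 mat"
  assumes A: "A \<in> carrier_mat n n" and B: "B \<in> carrier_mat n n" and BA: "B * A = 1\<^sub>m n"
    and xs: "sorted_wrt (<) xs" "set xs \<subseteq> {0..<n}" and ys: "sorted_wrt (<) ys" "set ys \<subseteq> {0..<n}"
    and len: "length xs = length ys"
  shows "minor A (complement_list n ys) (complement_list n xs) =
    (-1) ^ (sum_list xs + sum_list ys) * Determinant.det A * minor B xs ys"
proof -
  define xs' ys' where "xs' = complement_list n xs" and "ys' = complement_list n ys"
  have xs': "sorted_wrt (<) xs'" "set xs' \<subseteq> {0..<n}" "complement_list n xs' = xs"
    and ys': "sorted_wrt (<) ys'" "set ys' \<subseteq> {0..<n}" "complement_list n ys' = ys"
    using sorted_complement_list complement_complement_list[OF xs] complement_complement_list[OF ys]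
    by (auto simp: xs'_def ys'_def set_complement_list)
  have len': "length xs' = length ys'"
    using length_complement_list[OF xs] length_complement_list[OF ys] len by (simp add: xs'_def ys'_def)
  have dist: "distinct xs'" using xs'(1) by (simp add: strict_sorted_iff)
  \<comment> \<open>\<open>loc\<close> recovers the position of a row index in \<open>xs'\<close>,
    so that row \<open>xs' ! a\<close> of \<open>M\<close> can have its unit entry in column
    \<open>ys' ! a\<close>.\<close>
  define loc where "loc = inv_into {..<length xs'} (nth xs')"
  have loc: "loc (xs' ! i) = i" if "i < length xs'" for i
    unfolding loc_def using dist that by (intro inv_into_f_f) (auto intro: inj_on_nth)
  \<comment> \<open>\<open>M\<close> consists of the rows of \<open>B\<close> with index in \<open>xs\<close> and of unit rows, and \<open>M * A\<close> of unit rows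
    and the rows of \<open>A\<close> with index in \<open>ys'\<close>.\<close>
  define M where "M = mat n n (\<lambda>(i, j). if i \<in> set xs then B $$ (i, j)
      else if j = ys' ! loc i then 1 else 0)"
  have M: "M \<in> carrier_mat n n" by (simp add: M_def)
  have xs_mem: "xs ! i < n \<and> xs ! i \<in> set xs" if "i < length xs" for i
    using subsetD[OF xs(2) nth_mem[OF that]] that by simp
  have ys_mem: "ys ! i < n" if "i < length ys" for i
    using subsetD[OF ys(2) nth_mem[OF that]] that by simp
  have xs'_mem: "xs' ! i < n \<and> xs' ! i \<notin> set xs" if "i < length xs'" for i
    using nth_mem[OF that] by (auto simp: xs'_def set_complement_list)
  have ys'_mem: "ys' ! i < n" if "i < length ys'" for i
    using subsetD[OF ys'(2) nth_mem[OF that]] by simp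
  have "Determinant.det M = (-1) ^ (sum_list xs' + sum_list ys') * minor M xs ys"
    using det_unit_rows[OF M len' xs'(1,2) ys'(1,2)] xs'(3) ys'(3) xs'_mem loc by (simp add: M_def)
  also have "minor M xs ys = minor B xs ys"
    using xs_mem ys_mem len by (intro minor_cong) (simp_all add: M_def)
  finally have detM: "Determinant.det M = (-1) ^ (sum_list xs' + sum_list ys') * minor B xs ys" .
  have MA: "(M * A) $$ (i, j) = (if i \<in> set xs then (if i = j then 1 else 0) else A $$ (ys' ! loc i, j))"
    if ij: "i < n" "j < n" for i j
  proof (cases "i \<in> set xs")
    case True
    have "(M * A) $$ (i, j) = (\<Sum>l = 0..<n. M $$ (i, l) * A $$ (l, j))"
      using ij A M by (simp add: scalar_prod_def)
    also have "\<dots> = (\<Sum>l = 0..<n. B $$ (i, l) * A $$ (l, j))"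
      using True ij by (intro sum.cong) (simp_all add: M_def)
    also have "\<dots> = (B * A) $$ (i, j)"
      using ij A B by (simp add: scalar_prod_def)
    finally show ?thesis using True BA ij by simp
  next
    case False
    then have "i \<in> set xs'" using ij by (simp add: xs'_def set_complement_list)
    then obtain a where a: "a < length xs'" "i = xs' ! a" by (auto simp: in_set_conv_nth)
    then have loc_i: "loc i = a" "ys' ! a < n" using loc ys'_mem len' by auto
    have "(M * A) $$ (i, j) = (\<Sum>l = 0..<n. M $$ (i, l) * A $$ (l, j))"
      using ij A M by (simp add: scalar_prod_def)
    also have "\<dots> = (\<Sum>l = 0..<n. if l = ys' ! loc i then A $$ (l, j) else 0)"
      using False ij by (intro sum.cong) (simp_all add: M_def)
    also have "\<dots> = A $$ (ys' ! loc i, j)"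
      using loc_i by simp
    finally show ?thesis using False by simp
  qed
  have MA_carrier: "M * A \<in> carrier_mat n n" using M A by simp
  have "Determinant.det M * Determinant.det A = Determinant.det (M * A)"
    using det_mult[OF M A] by simp
  \<comment> \<open>The rows of \<open>M * A\<close> with index in \<open>xs\<close> are rows of
    \<open>B * A\<close>, the unit matrix. Their unit entries are diagonal, which makes the exponent
    even.\<close>
  also have "\<dots> = (-1) ^ (sum_list xs + sum_list xs) * minor (M * A) xs' xs'"
    unfolding xs'_def
  proof (rule det_unit_rows[OF MA_carrier refl xs xs])
    fix i j assume "i < length xs" "j < n"
    then show "(M * A) $$ (xs ! i, j) = (if j = xs ! i then 1 else 0)"
      using xs_mem[of i] MA[of "xs ! i" j] by (cases "j = xs ! i") simp_all
  qed
  also have "minor (M * A) xs' xs' = minor A ys' xs'"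
    using len' xs'_mem MA loc by (intro minor_cong) simp_all
  finally have "Determinant.det M * Determinant.det A = minor A ys' xs'"
    by (simp add: power_add power_mult_distrib[symmetric])
  \<comment> \<open>A list and its complement together always have the same sum, so passing to both
    complements keeps the parity.\<close>
  moreover have "(-1 :: 'a) ^ (sum_list xs' + sum_list ys') = (-1) ^ (sum_list xs + sum_list ys)"
  proof -
    have "sum_list xs + sum_list xs' = sum_list ys + sum_list ys'"
      using sum_list_complement_list[OF xs] sum_list_complement_list[OF ys] by (simp add: xs'_def ys'_def)
    then have "even (sum_list xs' + sum_list ys') = even (sum_list xs + sum_list ys)"
      by presburger
    then show ?thesis by (simp add: minus_one_power_iff)
  qed
  ultimately show ?thesis
    unfolding detM by (simp add: xs'_def ys'_def mult_ac)
qed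

section \<open>Powers of a network\<close>

locale glueable_network = ordered_network +
  assumes no_arc_into_source: "e \<in> arcs (dgraph N) \<Longrightarrow> head (dgraph N) e \<notin> sources N"
    and disjoint_ends: "sources N \<inter> sinks N = {}"
begin

lemma num_glue_power: "num (glue_power N n) = num N"
  by (cases n) (simp_all add: append_copy_def)

lemma glue_power_0_simps:
  "verts (dgraph (glue_power N 0)) = (\<lambda>i. (0, sink N i)) ` {1..num N}"
  "arcs (dgraph (glue_power N 0)) = {}" "num (glue_power N 0) = num N"
  "source (glue_power N 0) = (\<lambda>i. (0, sink N i))" "sink (glue_power N 0) = (\<lambda>i. (0, sink N i))"
  by simp_all

declare glue_power.simps(1) [simp del]

lemma glue_power_0_walk:
  assumes "pre_digraph.awalk (dgraph (glue_power N 0)) u p v"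
  shows "p = []" "u = v" "u \<in> verts (dgraph (glue_power N 0))"
proof -
  show "p = []"
    using assms by (cases p) (auto simp: pre_digraph.awalk_def glue_power_0_simps)
  with assms show "u = v" "u \<in> verts (dgraph (glue_power N 0))"
    by (auto simp: pre_digraph.awalk_def pre_digraph.cas.simps)
qed

lemma glue_power_0_paths:
  assumes "i \<in> {1..num N}" "j \<in> {1..num N}"
  shows "paths (glue_power N 0) (source (glue_power N 0) i) (sink (glue_power N 0) j) =
    (if i = j then {[]} else {})"
proof (cases "i = j")
  case True
  have "pre_digraph.awalk (dgraph (glue_power N 0)) (0, sink N i) [] (0, sink N i)"
    using assms(1) by (auto simp: pre_digraph.awalk_def pre_digraph.cas.simps glue_power_0_simps)
  then show ?thesis
    using True glue_power_0_walk(1) by (auto simp: paths_def glue_power_0_simps)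
next
  case False
  then have "sink N i \<noteq> sink N j" using assms inj_onD[OF inj_sink] by blast
  then have "(0 :: nat, sink N i) \<noteq> (0, sink N j)" by simp
  then show ?thesis
    using False glue_power_0_walk(2) by (auto simp: paths_def glue_power_0_simps)
qed

lemma glue_power_0_ordered: "ordered_network (glue_power N 0)"
proof -
  interpret G0: fin_digraph "dgraph (glue_power N 0)"
    by unfold_locales (simp_all add: glue_power_0_simps)
  have inj: "inj_on (\<lambda>i. (0 :: nat, sink N i)) {1..num N}"
  proof (rule inj_onI)
    fix i j assume "i \<in> {1..num N}" "j \<in> {1..num N}" "(0 :: nat, sink N i) = (0, sink N j)"
    then show "i = j" using inj_onD[OF inj_sink] by blast
  qed
  show ?thesis
  proof
    fix u p assume "G0.awalk u p u"
    then show "p = []" by (rule glue_power_0_walk)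
  next
    show "order_preserving (glue_power N 0)"
      unfolding order_preserving_def glue_power_0_simps(3)
    proof (intro allI impI)
      fix i j a b p q
      assume "1 \<le> i" "i < j" "j \<le> num N" "a \<in> {1..num N}" "b \<in> {1..num N}"
        "p \<in> paths (glue_power N 0) (source (glue_power N 0) i) (sink (glue_power N 0) a)"
        "q \<in> paths (glue_power N 0) (source (glue_power N 0) j) (sink (glue_power N 0) b)"
      then show "a < b"
        using glue_power_0_paths[of i a] glue_power_0_paths[of j b]
        by (auto split: if_splits)
    qed
  qed (use inj in \<open>auto simp: glue_power_0_simps\<close>)
qed

text \<open>The claims are proved jointly, since each gluing step presupposes the order property and
  the tag bounds for the preceding power.\<close>

lemma glue_power_invariant:
  "ordered_network (glue_power N n) \<and>
   (\<forall>v \<in> verts (dgraph (glue_power N n)). fst v < Suc n) \<and>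
   (\<forall>a \<in> arcs (dgraph (glue_power N n)). fst a < Suc n) \<and>
   path_matrix (glue_power N n) = path_matrix N ^\<^sub>m n"
proof (induction n)
  case 0
  have "path_matrix (glue_power N 0) = 1\<^sub>m (num N)"
  proof (rule eq_matI)
    fix i j assume "i < dim_row (1\<^sub>m (num N))" "j < dim_col (1\<^sub>m (num N))"
    then have ij: "Suc i \<in> {1..num N}" "Suc j \<in> {1..num N}" by auto
    then have "sink N (Suc i) = sink N (Suc j) \<longleftrightarrow> i = j"
      using inj_onD[OF inj_sink _ ij] by auto
    then show "path_matrix (glue_power N 0) $$ (i, j) = 1\<^sub>m (num N) $$ (i, j)"
      using ij glue_power_0_paths[OF ij] by (simp add: path_matrix_def glue_power_0_simps(3) path_weight_def)
  qed (simp_all add: path_matrix_def glue_power_0_simps(3))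
  then show ?case
    using glue_power_0_ordered by (auto simp: path_matrix_def glue_power_0_simps)
next
  case (Suc n)
  interpret H: ordered_network "glue_power N n" using Suc by blast
  interpret gluing N "glue_power N n" "Suc n"
    using Suc no_arc_into_source disjoint_ends num_glue_power by unfold_locales auto
  have "fst v < Suc (Suc n)" if v: "v \<in> verts (dgraph glued)" for v
  proof (cases "v \<in> verts (dgraph (glue_power N n))")
    case True
    then show ?thesis using old_verts by fastforce
  next
    case False
    then obtain w where "v = cv w" "w \<notin> sources N"
      using v cv_old_iff by (auto simp: glued_simps)
    then show ?thesis by (simp add: cv_other)
  qed
  moreover have "fst a < Suc (Suc n)" if a: "a \<in> arcs (dgraph glued)" for a
    using a old_arcs by (fastforce simp: glued_simps)
  ultimately show ?case
    using glued_ordered path_matrix_glued Suc by simp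
qed

lemma glue_power_ordered: "ordered_network (glue_power N n)"
  and path_matrix_glue_power: "path_matrix (glue_power N n) = path_matrix N ^\<^sub>m n"
  using glue_power_invariant[of n] by blast+

end

section \<open>Minors of the path matrix as sums over non-intersecting paths\<close>

text \<open>The lists contain the matrix indices, which are smaller by one than those of the paper.\<close>

definition index_list :: "nat set \<Rightarrow> nat list" where
  "index_list I = map (\<lambda>i. i - 1) (sorted_list_of_set I)"

text \<open>As the index lists are sorted, positions in the lists and numbers of sources or sinks
  increase together; this turns \<open>order_preserving\<close> into the hypothesis of the ordered
  lemma. The rest translates between tuples as functions and tuples as lists.\<close>

lemma (in ordered_network) minor_path_matrix:
  assumes I: "I \<subseteq> {1..num N}" "J \<subseteq> {1..num N}" "card I = card J"
  defines "us \<equiv> map (source N) (sorted_list_of_set I)" and "vs \<equiv> map (sink N) (sorted_list_of_set J)"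
  shows "(\<Sum>ps | ps \<in> path_tuples N us vs \<and> nonintersecting N us ps. tuple_weight N ps) =
    minor (path_matrix N) (index_list I) (index_list J)"
proof -
  define xs ys k where "xs = sorted_list_of_set I" and "ys = sorted_list_of_set J" and "k = card I"
  have fin: "finite I" "finite J" using I finite_subset by blast+
  have len: "length xs = k" "length ys = k" using I by (auto simp: xs_def ys_def k_def)
  have mem: "xs ! i \<in> {1..num N}" "ys ! i \<in> {1..num N}" if "i < k" for i
  proof -
    have "xs ! i \<in> set xs" "ys ! i \<in> set ys" using that len by simp_all
    then show "xs ! i \<in> {1..num N}" "ys ! i \<in> {1..num N}"
      using I fin by (auto simp: xs_def ys_def)
  qed
  have mono: "xs ! i < xs ! j" "ys ! i < ys ! j" if "i < j" "j < k" for i j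
    using that len strict_sorted_list_of_set[of I] strict_sorted_list_of_set[of J]
    by (auto simp: xs_def ys_def sorted_wrt_iff_nth_less)
  have mono': "i < j" if "ys ! i < ys ! j" "i < k" "j < k" for i j
    using that mono(2)[of j i] by (metis linorder_neqE_nat order_less_asym)
  define s t where "s = (\<lambda>i. source N (xs ! i))" and "t = (\<lambda>i. sink N (ys ! i))"
  have us: "length us = k" "length vs = k" "\<And>i. i < k \<Longrightarrow> us ! i = s i" "\<And>i. i < k \<Longrightarrow> vs ! i = t i"
    using len by (auto simp: us_def vs_def s_def t_def xs_def ys_def)
  define tuples where "tuples = {P \<in> walk_tuples k s t. common_vertices k s P = {}}"
  have entry: "path_matrix N $$ (index_list I ! i, index_list J ! j) =
      (\<Sum>q | awalk (s i) q (t j). prod_list (map (weight N) q))" if "i < k" "j < k" for i j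
  proof -
    have "xs ! i - 1 < num N" "ys ! j - 1 < num N" "Suc (xs ! i - 1) = xs ! i" "Suc (ys ! j - 1) = ys ! j"
      using mem[OF that(1)] mem[OF that(2)] by auto
    then show ?thesis
      using len that by (simp add: index_list_def path_matrix_def path_weight_def paths_def s_def t_def
          flip: xs_def ys_def)
  qed
  have "minor (path_matrix N) (index_list I) (index_list J) =
      Determinant.det (mat k k (\<lambda>(i, j). \<Sum>q | awalk (s i) q (t j). prod_list (map (weight N) q)))"
    unfolding minor_def using len(1) entry
    by (intro arg_cong[where f = Determinant.det] cong_mat) (simp_all add: index_list_def xs_def)
  also have "\<dots> = (\<Sum>P\<in>tuples. \<Prod>i=0..<k. prod_list (map (weight N) (P i)))"
    unfolding tuples_def
  proof (rule lindstroem_gessel_viennot_ordered[where w = "weight N" and k = k and s = s and t = t, simplified])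
    fix i j a b q r
    assume *: "i < j" "j < k" "a < k" "b < k" "awalk (s i) q (t a)" "awalk (s j) r (t b)"
      "set (awalk_verts (s i) q) \<inter> set (awalk_verts (s j) r) = {}"
    have "1 \<le> xs ! i" "xs ! i < xs ! j" "xs ! j \<le> num N"
      using mem[of i] mem[of j] mono *(1,2) by auto
    then have "ys ! a < ys ! b"
      using order_preserving mem(2)[OF *(3)] mem(2)[OF *(4)] *(5-7)
      unfolding order_preserving_def paths_def mem_Collect_eq s_def t_def by blast
    then show "a < b" using mono' *(3,4) by blast
  qed
  also have "\<dots> = (\<Sum>ps | ps \<in> path_tuples N us vs \<and> nonintersecting N us ps. tuple_weight N ps)"
  \<comment> \<open>\<open>undefined\<close> is the value that the functions in \<open>PiE\<close>
    take outside their domain.\<close>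
  proof (rule sum.reindex_bij_witness[where j = "\<lambda>P. map P [0..<k]" and
        i = "\<lambda>ps i. if i < k then ps ! i else undefined"])
    fix P assume P: "P \<in> tuples"
    then show "(\<lambda>i. if i < k then map P [0..<k] ! i else undefined) = P"
      by (auto simp: tuples_def walk_tuples_def PiE_iff extensional_def)
    show "map P [0..<k] \<in> {ps. ps \<in> path_tuples N us vs \<and> nonintersecting N us ps}"
      using P by (fastforce simp: tuples_def walk_tuples_def PiE_iff path_tuples_def nonintersecting_def
          common_vertices_def paths_def us)
    show "tuple_weight N (map P [0..<k]) = (\<Prod>i=0..<k. prod_list (map (weight N) (P i)))"
      by (simp add: tuple_weight_def path_weight_def prod.distinct_set_conv_list[symmetric] o_def)
  next
    fix ps assume "ps \<in> {ps. ps \<in> path_tuples N us vs \<and> nonintersecting N us ps}"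
    then have mem: "ps \<in> path_tuples N us vs" "nonintersecting N us ps" by simp_all
    have ps1: "length ps = k" using mem(1) by (simp add: path_tuples_def us)
    have ps2: "\<forall>i<k. awalk (s i) (ps ! i) (t i)"
      using mem(1) ps1 us by (simp add: path_tuples_def paths_def)
    have ps3: "\<forall>i<k. \<forall>j<k. i \<noteq> j \<longrightarrow>
         set (awalk_verts (s i) (ps ! i)) \<inter> set (awalk_verts (s j) (ps ! j)) = {}"
      using mem(2) us(3) unfolding nonintersecting_def ps1 by metis
    note ps = ps1 ps2 ps3
    show "map (\<lambda>i. if i < k then ps ! i else undefined) [0..<k] = ps"
      using ps(1) by (auto intro: nth_equalityI)
    have "common_vertices k s (\<lambda>i. if i < k then ps ! i else undefined) = {}"
      using ps(3) by (fastforce simp: common_vertices_def)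
    then show "(\<lambda>i. if i < k then ps ! i else undefined) \<in> tuples"
      using ps(2) by (simp add: tuples_def walk_tuples_def PiE_iff extensional_def)
  qed
  finally show ?thesis by simp
qed

lemma (in glueable_network) f_net_eq_minor:
  assumes "I \<subseteq> {1..num N}" "J \<subseteq> {1..num N}" "card I = card J"
  shows "f_net N I J n = minor (path_matrix N ^\<^sub>m n) (index_list I) (index_list J)"
proof -
  interpret H: ordered_network "glue_power N n" by (rule glue_power_ordered)
  show ?thesis
    using H.minor_path_matrix[of I J] assms
    by (simp add: f_net_def Let_def num_glue_power path_matrix_glue_power)
qed

section \<open>Linear recurrences on the integers\<close>

lemma sum_fun_apply: "(\<Sum>t\<in>T. g t) x = (\<Sum>t\<in>T. g t x :: 'a :: comm_monoid_add)"
  by (induction T rule: infinite_finite_induct) simp_all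

text \<open>All shifts of \<open>F\<close> lie in the span of at most \<open>card T\<close>
  functions on the integers, so \<open>card T + 1\<close> of them are linearly dependent.\<close>

lemma finite_dim_shift_relation:
  fixes h :: "'i \<Rightarrow> int \<Rightarrow> complex" and F :: "int \<Rightarrow> complex"
  assumes "finite T" and shift: "\<And>t z. t \<in> T \<Longrightarrow> h t (z + 1) = (\<Sum>u\<in>T. A t u * h u z)"
    and F: "\<And>z. F z = (\<Sum>t\<in>T. f t * h t z)"
  shows "\<exists>c. (\<exists>i\<le>card T. c i \<noteq> 0) \<and> (\<forall>z. (\<Sum>i\<le>card T. c i * F (z + int i)) = 0)"
proof -
  interpret fv: vector_space "\<lambda>(c :: complex) (g :: int \<Rightarrow> complex) z. c * g z"
    by unfold_locales (auto simp: fun_eq_iff algebra_simps)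
  define E where "E = (\<lambda>i z. F (z + int i))"
  have "\<exists>f. \<forall>z. F (z + int i) = (\<Sum>t\<in>T. f t * h t z)" for i
  proof (induction i)
    case 0
    then show ?case using F by (intro exI[of _ f]) simp
  next
    case (Suc i)
    then obtain g where g: "\<And>z. F (z + int i) = (\<Sum>t\<in>T. g t * h t z)" by blast
    have "F (z + int (Suc i)) = (\<Sum>u\<in>T. (\<Sum>t\<in>T. g t * A t u) * h u z)" for z
    proof -
      have "F (z + int (Suc i)) = F ((z + 1) + int i)" by (simp add: add_ac)
      also have "\<dots> = (\<Sum>t\<in>T. \<Sum>u\<in>T. g t * A t u * h u z)"
        using g shift by (simp add: sum_distrib_left mult_ac)
      also have "\<dots> = (\<Sum>u\<in>T. (\<Sum>t\<in>T. g t * A t u) * h u z)"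
        by (subst sum.swap) (simp add: sum_distrib_right)
      finally show ?thesis .
    qed
    then show ?case by (intro exI[of _ "\<lambda>u. \<Sum>t\<in>T. g t * A t u"]) blast
  qed
  then have span: "E i \<in> fv.span (h ` T)" for i
  proof -
    obtain g where g: "\<And>z. F (z + int i) = (\<Sum>t\<in>T. g t * h t z)"
      using \<open>\<And>i. \<exists>f. \<forall>z. F (z + int i) = (\<Sum>t\<in>T. f t * h t z)\<close>[of i] by blast
    have "E i = (\<Sum>t\<in>T. (\<lambda>z. g t * h t z))"
      by (simp add: E_def fun_eq_iff g sum_fun_apply)
    also have "\<dots> \<in> fv.span (h ` T)"
      by (intro fv.span_sum fv.span_scale fv.span_base) auto
    finally show ?thesis .
  qed
  show ?thesis
  \<comment> \<open>Dependence concerns the set of shifts, which has \<open>card T + 1\<close>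
    elements only if they are distinct; two equal shifts give a relation directly.\<close>
  proof (cases "inj_on E {..card T}")
    case True
    have "fv.dependent (E ` {..card T})"
    proof (rule ccontr)
      assume "\<not> fv.dependent (E ` {..card T})"
      then have "card (E ` {..card T}) \<le> card (h ` T)"
        using fv.independent_span_bound[of "h ` T" "E ` {..card T}"] span assms(1) by blast
      moreover have "card (h ` T) \<le> card T" using assms(1) by (rule card_image_le)
      ultimately show False using card_image[OF True] by simp
    qed
    then obtain c where c: "\<exists>v\<in>E ` {..card T}. c v \<noteq> 0"
        "(\<Sum>v\<in>E ` {..card T}. (\<lambda>z. c v * v z)) = 0"
      using fv.dependent_finite[of "E ` {..card T}"] by auto
    have "(\<Sum>i\<le>card T. c (E i) * F (z + int i)) = 0" for z
    proof -
      have "(\<Sum>i\<le>card T. c (E i) * E i z) = (\<Sum>v\<in>E ` {..card T}. (\<lambda>z. c v * v z)) z"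
        unfolding sum_fun_apply by (simp add: sum.reindex[OF True])
      then show ?thesis using c(2) by (simp add: E_def)
    qed
    then show ?thesis using c(1) by (intro exI[of _ "\<lambda>i. c (E i)"]) auto
  next
    case False
    then obtain i j where ij: "i \<le> card T" "j \<le> card T" "i \<noteq> j" "E i = E j"
      by (auto simp: inj_on_def)
    define c :: "nat \<Rightarrow> complex" where "c = (\<lambda>l. if l = i then 1 else if l = j then - 1 else 0)"
    have "(\<Sum>l\<le>card T. c l * F (z + int l)) = 0" for z
    proof -
      have "(\<Sum>l\<le>card T. c l * F (z + int l)) = (\<Sum>l\<in>{i, j}. c l * F (z + int l))"
        using ij by (intro sum.mono_neutral_right) (auto simp: c_def)
      also have "\<dots> = F (z + int i) - F (z + int j)"
        using ij(3) by (simp add: c_def)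
      also have "\<dots> = 0" using fun_cong[OF ij(4), of z] by (simp add: E_def)
      finally show ?thesis .
    qed
    moreover have "c i \<noteq> 0" by (simp add: c_def)
    ultimately show ?thesis using ij(1) by blast
  qed
qed

text \<open>The relation holds at every integer, so it may be used at \<open>z - int lo\<close>;
  this removes the vanishing low coefficients. Division by the highest nonzero coefficient
  normalises it.\<close>

lemma trim_relation:
  fixes c :: "nat \<Rightarrow> 'a :: field" and F :: "int \<Rightarrow> 'a"
  assumes "i0 \<le> D" "c i0 \<noteq> 0" and rel: "\<And>z. (\<Sum>i\<le>D. c i * F (z + int i)) = 0"
  obtains d b where "b 0 \<noteq> 0" "b d = 1" "\<And>z. (\<Sum>i\<le>d. b i * F (z + int i)) = 0"
proof -
  define S where "S = {i. i \<le> D \<and> c i \<noteq> 0}"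
  define lo hi where "lo = Min S" and "hi = Max S"
  have S: "finite S" "S \<noteq> {}" using assms(1,2) by (auto simp: S_def)
  have "lo \<in> S" "hi \<in> S" "lo \<le> hi" using S by (auto simp: lo_def hi_def)
  then have lo: "c lo \<noteq> 0" and hi: "c hi \<noteq> 0" "hi \<le> D" by (auto simp: S_def)
  define b where "b = (\<lambda>i. c (i + lo) / c hi)"
  have "(\<Sum>i\<le>hi - lo. b i * F (z + int i)) = 0" for z
  proof -
    have "(\<Sum>i\<le>hi - lo. c (i + lo) * F (z + int i)) =
        (\<Sum>i\<in>{0..hi - lo}. c (i + lo) * F (z - int lo + int (i + lo)))"
      by (intro sum.cong) auto
    also have "\<dots> = (\<Sum>i\<in>{lo..hi}. c i * F (z - int lo + int i))"
      using sum.shift_bounds_cl_nat_ivl[of "\<lambda>i. c i * F (z - int lo + int i)" 0 lo "hi - lo"] \<open>lo \<le> hi\<close>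
      by simp
    also have "\<dots> = (\<Sum>i\<le>D. c i * F (z - int lo + int i))"
    proof (rule sum.mono_neutral_left)
      show "\<forall>i\<in>{..D} - {lo..hi}. c i * F (z - int lo + int i) = 0"
      proof
        fix i assume i: "i \<in> {..D} - {lo..hi}"
        have "i \<notin> S"
        proof
          assume "i \<in> S"
          then have "lo \<le> i" "i \<le> hi" using S by (auto simp: lo_def hi_def)
          with i show False by simp
        qed
        then show "c i * F (z - int lo + int i) = 0" using i by (simp add: S_def)
      qed
    qed (use hi in auto)
    also have "\<dots> = 0" by (rule rel)
    finally have "(\<Sum>i\<le>hi - lo. c (i + lo) * F (z + int i)) / c hi = 0" by simp
    then show ?thesis by (simp add: b_def sum_divide_distrib)
  qed
  then show ?thesis
    using that[of b "hi - lo"] lo hi \<open>lo \<le> hi\<close> by (simp add: b_def)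
qed

text \<open>Reversing the coefficients makes \<open>b 0\<close> the last one, by which the backward
  recursion divides.\<close>

lemma recurrence_of_relation:
  assumes "b 0 \<noteq> 0" "b d = 1" and rel: "\<And>z. (\<Sum>i\<le>d. b i * F (z + int i)) = 0"
    and f: "\<And>n. f n = F (int n)"
  shows "recurrence f d (\<lambda>i. b (d - i))"
  unfolding recurrence_def
proof (intro conjI allI impI)
  fix n
  have "(\<Sum>i = 1..d. b (d - i) * f (n + d - i)) = (\<Sum>i<d. b i * F (int n + int i))"
    by (rule sum.reindex_bij_witness[where i = "\<lambda>i. d - i" and j = "\<lambda>i. d - i"]) (auto simp: f algebra_simps)
  moreover have "(\<Sum>i\<le>d. b i * F (int n + int i)) = (\<Sum>i<d. b i * F (int n + int i)) + b d * F (int n + int d)"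
    by (simp add: lessThan_Suc_atMost[symmetric])
  ultimately show "f (n + d) + (\<Sum>i = 1..d. b (d - i) * f (n + d - i)) = 0"
    using rel[of "int n"] assms(2) by (simp add: f add_ac)
qed (use assms(1) in simp)

text \<open>
  The defect of the recurrence is itself annihilated by the relation, whose lowest coefficient does
  not vanish; since it is zero on the natural numbers, it is zero everywhere.
\<close>

lemma extension_eq:
  assumes "b 0 \<noteq> 0" and rel: "\<And>z. (\<Sum>i\<le>e. b i * F (z + int i)) = 0"
    and f: "\<And>n. f n = F (int n)" and rec: "recurrence f d \<alpha>"
  shows "extension f d \<alpha> z = F z"
proof -
  define h where "h = (\<lambda>z. F (z + int d) + (\<Sum>i = 1..d. \<alpha> i * F (z + int d - int i)))"
  have h_nonneg: "h z = 0" if z: "z \<ge> 0" for z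
  proof -
    have eq: "f (nat z + d - i) = F (z + int d - int i)" if "i \<le> d" for i
      using that z by (simp add: f of_nat_diff)
    have "f (nat z + d) + (\<Sum>i = 1..d. \<alpha> i * f (nat z + d - i)) = 0"
      using rec unfolding recurrence_def by blast
    moreover have "f (nat z + d) = F (z + int d)" using eq[of 0] by simp
    moreover have "(\<Sum>i = 1..d. \<alpha> i * f (nat z + d - i)) = (\<Sum>i = 1..d. \<alpha> i * F (z + int d - int i))"
      using eq by (intro sum.cong) simp_all
    ultimately show ?thesis by (simp add: h_def)
  qed
  have h_rel: "(\<Sum>j\<le>e. b j * h (z + int j)) = 0" for z
  proof -
    have "(\<Sum>j\<le>e. b j * h (z + int j)) = (\<Sum>j\<le>e. b j * F ((z + int d) + int j)) +
        (\<Sum>j\<le>e. \<Sum>i = 1..d. b j * (\<alpha> i * F ((z + int d - int i) + int j)))"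
      unfolding sum.distrib[symmetric]
      by (intro sum.cong) (simp_all add: h_def distrib_left sum_distrib_left algebra_simps)
    also have "(\<Sum>j\<le>e. \<Sum>i = 1..d. b j * (\<alpha> i * F ((z + int d - int i) + int j))) =
        (\<Sum>i = 1..d. \<alpha> i * (\<Sum>j\<le>e. b j * F ((z + int d - int i) + int j)))"
      by (subst sum.swap) (simp add: sum_distrib_left mult.left_commute)
    finally show ?thesis unfolding rel by simp
  qed
  have "\<forall>z \<ge> - int m. h z = 0" for m
  proof (induction m)
    case 0
    then show ?case using h_nonneg by simp
  next
    case (Suc m)
    \<comment> \<open>In the relation at this point all terms except the one with coefficient
      \<open>b 0\<close> vanish by induction.\<close>
    have "h (- int (Suc m)) = 0"
    proof -
      have "h (- int (Suc m) + int j) = 0" if "j \<in> {1..e}" for j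
        using Suc that by simp
      then have "(\<Sum>j = 1..e. b j * h (- int (Suc m) + int j)) = 0"
        by (intro sum.neutral) simp
      moreover have "{..e} = insert 0 {1..e}" by auto
      ultimately have "b 0 * h (- int (Suc m)) = 0"
        using h_rel[of "- int (Suc m)"] by simp
      with assms(1) show ?thesis by simp
    qed
    moreover have "z = - int (Suc m) \<or> z \<ge> - int m" if "z \<ge> - int (Suc m)" for z
      using that by linarith
    ultimately show ?case using Suc by blast
  qed
  then have h: "h z = 0" for z
    by (metis minus_le_iff nat_le_iff nle_le)
  show ?thesis
  \<comment> \<open>A backward step uses only the values at \<open>z + 1, ..., z + d\<close>, which
    are closer to the naturals or among them.\<close>
  proof (induction "nat (- z)" arbitrary: z rule: less_induct)
    case less
    show ?case
    proof (cases "z \<ge> 0")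
      case True
      then show ?thesis by (subst extension.simps) (simp add: f)
    next
      case False
      show ?thesis
      \<comment> \<open>For \<open>d = 0\<close> the vanishing defect is \<open>F\<close> itself, in
        agreement with the default value 0 of the extension.\<close>
      proof (cases "d = 0")
        case True
        then show ?thesis
          using False h[of z] by (subst extension.simps) (simp add: h_def)
      next
        case d: False
        have \<alpha>: "\<alpha> d \<noteq> 0" using rec d by (simp add: recurrence_def)
        have IH: "extension f d \<alpha> (z + int d - int i) = F (z + int d - int i)" if "i < d" for i
          using that False by (intro less) simp
        have "extension f d \<alpha> z = - 1 / \<alpha> d *
          (extension f d \<alpha> (z + int d) + (\<Sum>i = 1..d - 1. \<alpha> i * extension f d \<alpha> (z + int d - int i)))"
          using False d by (subst extension.simps) simp
        also have "\<dots> = - 1 / \<alpha> d * (F (z + int d) + (\<Sum>i = 1..d - 1. \<alpha> i * F (z + int d - int i)))"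
        proof -
          have "extension f d \<alpha> (z + int d) = F (z + int d)" using IH[of 0] d by simp
          moreover have "(\<Sum>i = 1..d - 1. \<alpha> i * extension f d \<alpha> (z + int d - int i)) =
              (\<Sum>i = 1..d - 1. \<alpha> i * F (z + int d - int i))"
            using IH d by (intro sum.cong) auto
          ultimately show ?thesis by simp
        qed
        also have "F (z + int d) + (\<Sum>i = 1..d - 1. \<alpha> i * F (z + int d - int i)) = - (\<alpha> d * F z)"
        proof -
          have "{1..d} = insert d {1..d - 1}" "d \<notin> {1..d - 1}" using d by auto
          then have "(\<Sum>i = 1..d. \<alpha> i * F (z + int d - int i)) =
              \<alpha> d * F z + (\<Sum>i = 1..d - 1. \<alpha> i * F (z + int d - int i))"
            by (simp only: sum.insert finite_atLeastAtMost) simp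
          then show ?thesis using h[of z] by (simp add: h_def eq_neg_iff_add_eq_0 add_ac)
        qed
        finally show ?thesis using \<alpha> by simp
      qed
    qed
  qed
qed

section \<open>Integer powers of a matrix and their minors\<close>

definition int_pow_mat :: "'a :: semiring_1 mat \<Rightarrow> 'a mat \<Rightarrow> int \<Rightarrow> 'a mat" where
  "int_pow_mat A B z = (if z \<ge> 0 then A ^\<^sub>m nat z else B ^\<^sub>m nat (- z))"

lemma int_pow_mat_carrier:
  "A \<in> carrier_mat n n \<Longrightarrow> B \<in> carrier_mat n n \<Longrightarrow> int_pow_mat A B z \<in> carrier_mat n n"
  by (simp add: int_pow_mat_def)

lemma int_pow_mat_add_1:
  fixes A B :: "'a :: semiring_1 mat"
  assumes A: "A \<in> carrier_mat n n" and B: "B \<in> carrier_mat n n" and BA: "B * A = 1\<^sub>m n"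
  shows "int_pow_mat A B (z + 1) = int_pow_mat A B z * A"
proof (cases "z \<ge> 0")
  case True
  then have "nat (z + 1) = Suc (nat z)" by simp
  with True show ?thesis by (simp add: int_pow_mat_def)
next
  case False
  define m where "m = nat (- z) - 1"
  have m: "nat (- z) = Suc m" "z + 1 = - int m" using False by (auto simp: m_def)
  have Bm: "B ^\<^sub>m m \<in> carrier_mat n n" using B by simp
  have "int_pow_mat A B z * A = B ^\<^sub>m m * B * A"
    using False m by (simp add: int_pow_mat_def)
  also have "\<dots> = B ^\<^sub>m m"
    by (simp only: assoc_mult_mat[OF Bm B A] BA right_mult_one_mat[OF Bm])
  also have "\<dots> = int_pow_mat A B (z + 1)"
  \<comment> \<open>At \<open>z + 1 = 0\<close> the definition switches from powers of
    \<open>B\<close> to powers of \<open>A\<close>; both zeroth powers are the unit matrix.\<close>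
  proof (cases "m = 0")
    case True
    then show ?thesis using m(2) A B by (simp add: int_pow_mat_def)
  next
    case False
    then show ?thesis unfolding m(2) by (simp add: int_pow_mat_def)
  qed
  finally show ?thesis by simp
qed

text \<open>The Leibniz formula writes the minor as a combination of the products
  \<open>h (a, b)\<close> of \<open>k\<close> entries, and the step from \<open>z\<close> to
  \<open>z + 1\<close> maps their span into itself.\<close>

lemma minor_int_pow_relation:
  fixes A B :: "complex mat"
  assumes A: "A \<in> carrier_mat n n" and B: "B \<in> carrier_mat n n" and BA: "B * A = 1\<^sub>m n"
    and xs: "set xs \<subseteq> {0..<n}" and ys: "set ys \<subseteq> {0..<n}" "length xs = length ys"
  obtains d b where "b 0 \<noteq> 0" "b d = 1"
    "\<And>z. (\<Sum>i\<le>d. b i * minor (int_pow_mat A B (z + int i)) xs ys) = 0"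
proof -
  define k where "k = length xs"
  define Q where "Q = int_pow_mat A B"
  define maps where "maps = PiE {0..<k} (\<lambda>_. {0..<n})"
  define T where "T = maps \<times> maps"
  define h :: "(nat \<Rightarrow> nat) \<times> (nat \<Rightarrow> nat) \<Rightarrow> int \<Rightarrow> complex"
    where "h = (\<lambda>(a, b) z. \<Prod>i=0..<k. Q z $$ (a i, b i))"
  \<comment> \<open>\<open>S\<close> is the matrix of the shift. Multiplication by \<open>A\<close>
    from the right leaves the row indices \<open>a\<close> alone and acts on the \<open>k\<close>
    column indices like the k-fold tensor power of \<open>A\<close>.\<close>
  define S :: "(nat \<Rightarrow> nat) \<times> (nat \<Rightarrow> nat) \<Rightarrow> (nat \<Rightarrow> nat) \<times> (nat \<Rightarrow> nat) \<Rightarrow> complex"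
    where "S = (\<lambda>(a, b) (a', b'). if a' = a then \<Prod>i=0..<k. A $$ (b' i, b i) else 0)"
  define a0 where "a0 = restrict ((!) xs) {0..<k}"
  define b0 where "b0 = (\<lambda>p :: nat \<Rightarrow> nat. restrict (\<lambda>i. ys ! p i) {0..<k})"
  define perms where "perms = {p. p permutes {0..<k}}"
  have fin: "finite maps" unfolding maps_def by (intro finite_PiE) auto
  have Q: "Q z \<in> carrier_mat n n" for z unfolding Q_def by (rule int_pow_mat_carrier[OF A B])
  have entry: "Q (z + 1) $$ (i, j) = (\<Sum>l = 0..<n. A $$ (l, j) * Q z $$ (i, l))" if "i < n" "j < n" for z i j
    using that A Q[of z] int_pow_mat_add_1[OF A B BA, of z]
    by (simp add: Q_def scalar_prod_def mult.commute)
  have shift: "h t (z + 1) = (\<Sum>u\<in>T. S t u * h u z)" if "t \<in> T" for t z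
  proof -
    obtain a b where t: "t = (a, b)" "a \<in> maps" "b \<in> maps" using \<open>t \<in> T\<close> by (auto simp: T_def)
    have ab: "a i < n" "b i < n" if "i \<in> {0..<k}" for i
      using t that by (auto simp: maps_def PiE_iff)
    have "h t (z + 1) = (\<Prod>i=0..<k. \<Sum>l\<in>{0..<n}. A $$ (l, b i) * Q z $$ (a i, l))"
      using entry ab by (simp add: t h_def)
    also have "\<dots> = (\<Sum>c\<in>maps. \<Prod>i=0..<k. A $$ (c i, b i) * Q z $$ (a i, c i))"
      unfolding maps_def by (rule prod_sum_PiE) auto
    also have "\<dots> = (\<Sum>c\<in>maps. (\<Prod>i=0..<k. A $$ (c i, b i)) * h (a, c) z)"
      by (simp add: prod.distrib h_def)
    also have "\<dots> = (\<Sum>a'\<in>maps. \<Sum>c\<in>maps. if a' = a then (\<Prod>i=0..<k. A $$ (c i, b i)) * h (a, c) z else 0)"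
      using t(2) fin by (subst sum.swap) simp
    also have "\<dots> = (\<Sum>a'\<in>maps. \<Sum>c\<in>maps. S t (a', c) * h (a', c) z)"
      by (intro sum.cong refl) (auto simp: S_def t)
    also have "\<dots> = (\<Sum>u\<in>T. S t u * h u z)"
      unfolding T_def by (simp add: sum.cartesian_product case_prod_beta)
    finally show ?thesis .
  qed
  have a0: "a0 \<in> maps"
    using xs nth_mem[of _ xs] by (force simp: a0_def maps_def k_def)
  have b0: "b0 p \<in> maps" if "p \<in> perms" for p
  proof -
    have "ys ! p i < n" if i: "i < k" for i
    proof -
      have "p i < length ys"
        using permutes_in_image[of p "{0..<k}" i] \<open>p \<in> perms\<close> i ys(2) by (simp add: perms_def k_def)
      then show ?thesis using subsetD[OF ys(1) nth_mem] by simp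
    qed
    then show ?thesis by (auto simp: b0_def maps_def)
  qed
  \<comment> \<open>The coefficient of \<open>t\<close> is a sum over \<open>p\<close>, since
    entries of \<open>ys\<close> may repeat and several permutations may then give the same
    \<open>b0 p\<close>.\<close>
  have F: "minor (Q z) xs ys = (\<Sum>t\<in>T. (\<Sum>p\<in>perms. if t = (a0, b0 p) then of_int (sign p) else 0) * h t z)" for z
  proof -
    have "minor (Q z) xs ys = (\<Sum>p\<in>perms. of_int (sign p) * (\<Prod>i=0..<k. Q z $$ (xs ! i, ys ! p i)))"
      unfolding minor_def perms_def k_def[symmetric]
      by (subst det_def'[of _ k])
        (auto intro!: sum.cong prod.cong dest: permutes_in_image[of _ "{0..<k}"])
    also have "\<dots> = (\<Sum>p\<in>perms. of_int (sign p) * h (a0, b0 p) z)"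
      by (simp add: h_def a0_def b0_def)
    also have "\<dots> = (\<Sum>p\<in>perms. \<Sum>t\<in>T. if t = (a0, b0 p) then of_int (sign p) * h t z else 0)"
      using a0 b0 fin by (intro sum.cong refl) (simp add: T_def)
    also have "\<dots> = (\<Sum>t\<in>T. (\<Sum>p\<in>perms. if t = (a0, b0 p) then of_int (sign p) else 0) * h t z)"
      by (subst sum.swap) (auto simp: sum_distrib_right intro!: sum.cong)
    finally show ?thesis .
  qed
  have "finite T" using fin by (simp add: T_def)
  from finite_dim_shift_relation[where h = h and A = S, OF this shift F]
  obtain c i0 where c: "i0 \<le> card T" "c i0 \<noteq> 0"
    "\<And>z. (\<Sum>i\<le>card T. c i * minor (Q (z + int i)) xs ys) = 0"
    by blast
  obtain d b where "b 0 \<noteq> 0" "b d = 1" "\<And>z. (\<Sum>i\<le>d. b i * minor (Q (z + int i)) xs ys) = 0"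
    using trim_relation[of i0 "card T" c "\<lambda>z. minor (Q z) xs ys", OF c] by blast
  then show ?thesis using that unfolding Q_def by blast
qed

text \<open>The claim on sums is kept additive to avoid subtraction of naturals. It shows that
  passing from labels to matrix indices lowers the sum by the cardinality, which for two sets of
  equal size does not affect the sign.\<close>

lemma index_list_properties:
  assumes "I \<subseteq> {1..m}"
  shows "sorted_wrt (<) (index_list I)" "set (index_list I) \<subseteq> {0..<m}"
    "length (index_list I) = card I" "sum_list (index_list I) + card I = \<Sum>I"
    "index_list ({1..m} - I) = complement_list m (index_list I)"
proof -
  have sorted: "sorted_wrt (<) (index_list I)" if "I \<subseteq> {1..m}" for I
  proof -
    have fin: "finite I" using that finite_subset by blast
    show ?thesis
      unfolding index_list_def sorted_wrt_map
    proof (rule sorted_wrt_mono_rel[OF _ strict_sorted_list_of_set])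
      fix i j assume "i \<in> set (sorted_list_of_set I)" "i < j"
      then show "i - 1 < j - 1" using fin subsetD[OF that, of i] by auto
    qed
  qed
  have fin: "finite I" using assms finite_subset by blast
  show "sorted_wrt (<) (index_list I)" using sorted[OF assms] .
  show "set (index_list I) \<subseteq> {0..<m}" using assms fin by (force simp: index_list_def)
  show "length (index_list I) = card I" by (simp add: index_list_def)
  have "sum_list (index_list I) = (\<Sum>i\<in>I. i - 1)"
    using fin by (simp add: index_list_def sum.distinct_set_conv_list[symmetric])
  moreover have "(\<Sum>i\<in>I. i - 1) + card I = (\<Sum>i\<in>I. (i - 1) + 1)"
    unfolding sum.distrib by simp
  moreover have "(\<Sum>i\<in>I. (i - 1) + 1) = \<Sum>I"
    using assms by (intro sum.cong) force+
  ultimately show "sum_list (index_list I) + card I = \<Sum>I" by simp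
  show "index_list ({1..m} - I) = complement_list m (index_list I)"
  proof (rule strict_sorted_eqI[OF sorted sorted_complement_list])
    show "set (index_list ({1..m} - I)) = set (complement_list m (index_list I))"
    proof (intro equalityI subsetI)
      fix i assume "i \<in> set (index_list ({1..m} - I))"
      then obtain j where j: "j \<in> {1..m}" "j \<notin> I" "i = j - 1" by (auto simp: index_list_def)
      have "j - 1 \<noteq> l - 1" if "l \<in> I" for l
        using j that subsetD[OF assms that] by (auto simp: eq_diff_iff)
      then show "i \<in> set (complement_list m (index_list I))"
        using j fin by (auto simp: set_complement_list index_list_def)
    next
      fix i assume "i \<in> set (complement_list m (index_list I))"
      then have i: "i < m" "i \<notin> (\<lambda>i. i - 1) ` I"
        using fin by (auto simp: set_complement_list index_list_def)
      then have "Suc i \<notin> I" by force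
      with i show "i \<in> set (index_list ({1..m} - I))"
        by (force simp: index_list_def)
    qed
  qed auto
qed

lemma inverse_mat_exists:
  fixes A :: "'a :: field mat"
  assumes "A \<in> carrier_mat n n" "Determinant.det A \<noteq> 0"
  obtains B where "B \<in> carrier_mat n n" "B * A = 1\<^sub>m n"
  using det_non_zero_imp_unit[OF assms, of "()"] that
  by (auto simp: Units_def ring_mat_def)

lemma det_pow_mat:
  fixes A :: "'a :: comm_ring_1 mat"
  assumes "A \<in> carrier_mat n n"
  shows "Determinant.det (A ^\<^sub>m k) = Determinant.det A ^ k"
  using assms by (induction k) (simp_all add: det_mult[where n = n])

text \<open>At \<open>z = - int k\<close> this makes the negative power a left inverse of
  \<open>A ^\<^sub>m k\<close>.\<close>

lemma int_pow_mat_mult_pow: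
  fixes A B :: "'a :: semiring_1 mat"
  assumes A: "A \<in> carrier_mat n n" and B: "B \<in> carrier_mat n n" and BA: "B * A = 1\<^sub>m n"
  shows "int_pow_mat A B z * A ^\<^sub>m k = int_pow_mat A B (z + int k)"
proof (induction k)
  case 0
  show ?case using A int_pow_mat_carrier[OF A B, of z] by simp
next
  case (Suc k)
  have "int_pow_mat A B z * A ^\<^sub>m Suc k = int_pow_mat A B z * A ^\<^sub>m k * A"
    using assoc_mult_mat[OF int_pow_mat_carrier[OF A B, of z] pow_carrier_mat[OF A] A] by simp
  also have "\<dots> = int_pow_mat A B (z + int k + 1)"
    unfolding Suc int_pow_mat_add_1[OF A B BA] ..
  finally show ?case by (simp add: add_ac)
qed

theorem theorem2p3:
  fixes G :: "('v, 'e) network" and I J :: "nat set"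
  assumes "planar_network G"
    and "acyclic_network G"
    and "sources G \<inter> sinks G = {}"
    and "Determinant.det (path_matrix G) \<noteq> 0"
    and "I \<subseteq> {1..num G}" and "J \<subseteq> {1..num G}" and "card I = card J"
  shows "satisfies_linear_recurrence (f_net G I J) \<and>
    (Determinant.det (path_matrix G) = 1 \<longrightarrow>
      (\<forall>d \<alpha>. recurrence (f_net G I J) d \<alpha> \<longrightarrow>
        (\<forall>n \<ge> 1. extension (f_net G I J) d \<alpha> (- int n) =
           (- 1) ^ (\<Sum>I + \<Sum>J) * f_net G ({1..num G} - J) ({1..num G} - I) n)))"
proof -
  interpret ordered_network G by (rule planar_network_ordered[OF assms(1,2)])
  interpret glueable_network G
    using planar_network_no_arc_into_source[OF assms(1)] assms(3) by unfold_locales auto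
  define m P xs ys where "m = num G" and "P = path_matrix G" and "xs = index_list I" and "ys = index_list J"
  have P: "P \<in> carrier_mat m m" by (simp add: P_def m_def path_matrix_def)
  obtain B where B: "B \<in> carrier_mat m m" and BP: "B * P = 1\<^sub>m m"
    using inverse_mat_exists[OF P] assms(4) by (auto simp: P_def)
  note xs = index_list_properties[OF assms(5), folded xs_def m_def]
  note ys = index_list_properties[OF assms(6), folded ys_def m_def]
  have len: "length xs = length ys" using xs(3) ys(3) assms(7) by simp
  define F where "F = (\<lambda>z. minor (int_pow_mat P B z) xs ys)"
  have f: "f_net G I J n = F (int n)" for n
    using f_net_eq_minor[OF assms(5-7)] by (simp add: F_def int_pow_mat_def P_def xs_def ys_def)
  obtain d b where rel: "b 0 \<noteq> 0" "b d = 1" "\<And>z. (\<Sum>i\<le>d. b i * F (z + int i)) = 0"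
    using minor_int_pow_relation[OF P B BP xs(2) ys(2) len] unfolding F_def by blast
  have "satisfies_linear_recurrence (f_net G I J)"
    unfolding satisfies_linear_recurrence_def
    using recurrence_of_relation[OF rel f] by blast
  moreover have "extension (f_net G I J) e \<alpha> (- int n) =
      (- 1) ^ (\<Sum>I + \<Sum>J) * f_net G ({1..num G} - J) ({1..num G} - I) n"
    if det: "Determinant.det (path_matrix G) = 1" and rec: "recurrence (f_net G I J) e \<alpha>" for e \<alpha> n
  proof -
    define Q where "Q = int_pow_mat P B (- int n)"
    have Q: "Q \<in> carrier_mat m m" unfolding Q_def by (rule int_pow_mat_carrier[OF P B])
    have QP: "Q * P ^\<^sub>m n = 1\<^sub>m m"
      using int_pow_mat_mult_pow[OF P B BP, of "- int n" n] P by (simp add: Q_def int_pow_mat_def)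
    have Pn: "P ^\<^sub>m n \<in> carrier_mat m m" using P by simp
    have detPn: "Determinant.det (P ^\<^sub>m n) = 1"
      using det det_pow_mat[OF P] by (simp add: P_def)
    have "finite I" "finite J" using assms(5,6) finite_subset by blast+
    then have "card ({1..num G} - J) = card ({1..num G} - I)"
      using assms(5-7) by (simp only: card_Diff_subset)
    then have "f_net G ({1..num G} - J) ({1..num G} - I) n =
        minor (P ^\<^sub>m n) (complement_list m ys) (complement_list m xs)"
      using f_net_eq_minor[of "{1..num G} - J" "{1..num G} - I" n] xs(5) ys(5) by (simp add: P_def m_def)
    \<comment> \<open>Passing to the inverse interchanges rows and columns: \<open>Q\<close> has
      rows \<open>I\<close> and columns \<open>J\<close>, while \<open>P^n\<close> has the rows
      outside \<open>J\<close> and the columns outside \<open>I\<close>.\<close>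
    also have "\<dots> = (- 1) ^ (sum_list xs + sum_list ys) * minor Q xs ys"
      using jacobi_complementary_minor[OF Pn Q QP xs(1,2) ys(1,2) len] detPn by simp
    also have "(- 1 :: complex) ^ (sum_list xs + sum_list ys) = (- 1) ^ (\<Sum>I + \<Sum>J)"
    proof -
      have "\<Sum>I + \<Sum>J = sum_list xs + sum_list ys + 2 * card I"
        using xs(4) ys(4) assms(7) by simp
      then show ?thesis by (simp add: power_add power_mult)
    qed
    \<comment> \<open>\<open>F\<close> does not depend on \<open>e\<close> and
      \<open>\<alpha>\<close>, so whichever recurrence is run backwards, the result is the
      same.\<close>
    also have "minor Q xs ys = extension (f_net G I J) e \<alpha> (- int n)"
      using extension_eq[OF rel(1,3) f rec] by (simp add: F_def Q_def)
    finally show ?thesis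
      by (simp add: power_mult_distrib[symmetric] mult.assoc[symmetric])
  qed
  ultimately show ?thesis by blast
qed

end
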